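(* Let $(M,g)$ be a Riemannian manifold with Levi-Civita connection $\nabla^g$, and let $f:M\to\mathbb{R}$ be a smooth function. Let $M^\circ$ denote $M$ minus the set of critical points of $f$. Then there exists a symmetric (torsion-free) affine connection $\tilde\nabla^f$ on $M^\circ$ defined by $$\tilde\nabla^f_XY:=\nabla^g_XY-g(X,Y)\,\frac{\nabla^g_{\operatorname{grad}f}\operatorname{grad}f-\lambda\operatorname{grad}f}{\|\operatorname{grad}f\|^2}$$ for some real function $\lambda$, and satisfying $$\tilde\nabla^f_{\operatorname{grad}f}\operatorname{grad}f=\lambda\operatorname{grad}f .$$ Hence, every gradient curve of $f$ is a pregeodesic of $\tilde\nabla^f$.
   Context: The Riemannian gradient of $f$ is defined by $g(\operatorname{grad}f,\cdot)=\mathrm{d}f$, and $\|\cdot\|$ is the norm induced by $g$. Here $X,Y$ are arbitrary smooth vector fields on $M^\circ$. A gradient curve of $f$ is an integral curve of the gradient vector field of $f$ (or of its negative, in the case of gradient descent) in $M^\circ$. A pregeodesic of a connection $\nabla$ is a curve that is a geodesic of $\nabla$ up to reparametrization, i.e. a curve $\gamma$ such that $\nabla_{\dot\gamma}\dot\gamma$ is a (function) multiple of $\dot\gamma$. *)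

theory Defs
  imports "HOL-Analysis.Analysis"
begin

section \<open>Smooth maps between Euclidean spaces\<close>

(* Intended for open S: f is C^k iff it is differentiable and all its directional
   derivatives are C^(k-1). *)
primrec Ck_on :: "nat \<Rightarrow> 'a::real_normed_vector set \<Rightarrow> ('a \<Rightarrow> 'b::real_normed_vector) \<Rightarrow> bool" where
  "Ck_on 0 = (\<lambda>S f. continuous_on S f)"
| "Ck_on (Suc k) = (\<lambda>S f. (\<forall>x\<in>S. f differentiable (at x)) \<and>
     (\<forall>v. Ck_on k S (\<lambda>x. frechet_derivative f (at x) v)))"

definition smooth_on :: "'a::real_normed_vector set \<Rightarrow> ('a \<Rightarrow> 'b::real_normed_vector) \<Rightarrow> bool" where
  "smooth_on S f \<longleftrightarrow> (\<forall>k. Ck_on k S f)"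

section \<open>Smooth manifolds, functions and curves\<close>

(* (V, phi): the values of phi outside V are irrelevant. *)
type_synonym ('m, 'e) chart = "'m set \<times> ('m \<Rightarrow> 'e)"

definition is_chart :: "('m::topological_space, 'e::euclidean_space) chart \<Rightarrow> bool" where
  "is_chart = (\<lambda>(V, \<phi>). open V \<and> open (\<phi> ` V) \<and> homeomorphism V (\<phi> ` V) \<phi> (inv_into V \<phi>))"

(* The manifold is the union of the chart domains, of dimension DIM('e).  The atlas need not
   be maximal: the notions below are the same for every compatible atlas. *)
definition carrier :: "('m, 'e) chart set \<Rightarrow> 'm set" where
  "carrier A = (\<Union>(V, \<phi>)\<in>A. V)"

definition smooth_manifold ::
    "('m::{t2_space,second_countable_topology}, 'e::euclidean_space) chart set \<Rightarrow> bool" where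
  "smooth_manifold A \<longleftrightarrow> (\<forall>c\<in>A. is_chart c) \<and>
     (\<forall>(V, \<phi>)\<in>A. \<forall>(V', \<phi>')\<in>A. smooth_on (\<phi> ` (V \<inter> V')) (\<phi>' \<circ> inv_into V \<phi>))"

definition smooth_fun ::
    "('m::topological_space, 'e::euclidean_space) chart set \<Rightarrow> 'm set \<Rightarrow> ('m \<Rightarrow> real) \<Rightarrow> bool" where
  "smooth_fun A U h \<longleftrightarrow> open U \<and> U \<subseteq> carrier A \<and>
     (\<forall>(V, \<phi>)\<in>A. smooth_on (\<phi> ` (U \<inter> V)) (h \<circ> inv_into V \<phi>))"

definition smooth_near ::
    "('m::topological_space, 'e::euclidean_space) chart set \<Rightarrow> 'm \<Rightarrow> ('m \<Rightarrow> real) \<Rightarrow> bool" where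
  "smooth_near A p h \<longleftrightarrow> (\<exists>U. p \<in> U \<and> smooth_fun A U h)"

definition smooth_curve ::
    "('m::topological_space, 'e::euclidean_space) chart set \<Rightarrow> real set \<Rightarrow> (real \<Rightarrow> 'm) \<Rightarrow> bool" where
  "smooth_curve A I \<gamma> \<longleftrightarrow> open I \<and> is_interval I \<and> continuous_on I \<gamma> \<and> \<gamma> ` I \<subseteq> carrier A \<and>
     (\<forall>(V, \<phi>)\<in>A. smooth_on {t \<in> I. \<gamma> t \<in> V} (\<phi> \<circ> \<gamma>))"

section \<open>Tangent vectors and vector fields\<close>

(* A tangent vector at p is the derivation h |-> (h o gamma)'(0), on functions h smooth near p,
   given by a smooth curve gamma through p.  On all other h it is set to 0, so that tangent
   vectors are equal as HOL functions iff they are equal as derivations. *)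
type_synonym 'm tangent = "('m \<Rightarrow> real) \<Rightarrow> real"

type_synonym 'm vfield = "'m \<Rightarrow> 'm tangent"

definition velocity ::
    "('m::topological_space, 'e::euclidean_space) chart set \<Rightarrow> (real \<Rightarrow> 'm) \<Rightarrow> real \<Rightarrow> 'm tangent" where
  "velocity A \<gamma> t = (\<lambda>h. if smooth_near A (\<gamma> t) h then deriv (\<lambda>s. h (\<gamma> s)) t else 0)"

definition tangent_space ::
    "('m::topological_space, 'e::euclidean_space) chart set \<Rightarrow> 'm \<Rightarrow> 'm tangent set" where
  "tangent_space A p =
     {velocity A \<gamma> 0 |\<gamma>. \<exists>\<epsilon>>0. smooth_curve A {-\<epsilon><..<\<epsilon>} \<gamma> \<and> \<gamma> 0 = p}"

(* Smooth vector fields on the open set U; the values outside U are irrelevant. *)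
definition smooth_vf ::
    "('m::topological_space, 'e::euclidean_space) chart set \<Rightarrow> 'm set \<Rightarrow> 'm vfield \<Rightarrow> bool" where
  "smooth_vf A U X \<longleftrightarrow> open U \<and> U \<subseteq> carrier A \<and> (\<forall>p\<in>U. X p \<in> tangent_space A p) \<and>
     (\<forall>V h. V \<subseteq> U \<and> smooth_fun A V h \<longrightarrow> smooth_fun A V (\<lambda>p. X p h))"

definition lie_bracket ::
    "('m::topological_space, 'e::euclidean_space) chart set \<Rightarrow> 'm vfield \<Rightarrow> 'm vfield \<Rightarrow> 'm vfield" where
  "lie_bracket A X Y p =
     (\<lambda>h. if smooth_near A p h then X p (\<lambda>q. Y q h) - Y p (\<lambda>q. X q h) else 0)"

section \<open>Riemannian metrics and gradients\<close>

type_synonym 'm metric = "'m \<Rightarrow> 'm tangent \<Rightarrow> 'm tangent \<Rightarrow> real"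

definition riemannian_metric ::
    "('m::topological_space, 'e::euclidean_space) chart set \<Rightarrow> 'm metric \<Rightarrow> bool" where
  "riemannian_metric A g \<longleftrightarrow>
     (\<forall>p\<in>carrier A. \<forall>u\<in>tangent_space A p. \<forall>v\<in>tangent_space A p. \<forall>w\<in>tangent_space A p. \<forall>r s.
        g p (\<lambda>h. r * u h + s * v h) w = r * g p u w + s * g p v w) \<and>
     (\<forall>p\<in>carrier A. \<forall>u\<in>tangent_space A p. \<forall>v\<in>tangent_space A p. g p u v = g p v u) \<and>
     (\<forall>p\<in>carrier A. \<forall>v\<in>tangent_space A p. v \<noteq> (\<lambda>h. 0) \<longrightarrow> g p v v > 0) \<and>
     (\<forall>U X Y. smooth_vf A U X \<and> smooth_vf A U Y \<longrightarrow> smooth_fun A U (\<lambda>p. g p (X p) (Y p)))"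

definition metric_norm :: "'m metric \<Rightarrow> 'm \<Rightarrow> 'm tangent \<Rightarrow> real" where
  "metric_norm g p v = sqrt (g p v v)"

(* The differential of f at p is v |-> v f. *)
definition gradient ::
    "('m::topological_space, 'e::euclidean_space) chart set \<Rightarrow> 'm metric \<Rightarrow> ('m \<Rightarrow> real) \<Rightarrow> 'm vfield" where
  "gradient A g f p =
     (THE w. w \<in> tangent_space A p \<and> (\<forall>v\<in>tangent_space A p. g p w v = v f))"

definition critical_point ::
    "('m::topological_space, 'e::euclidean_space) chart set \<Rightarrow> ('m \<Rightarrow> real) \<Rightarrow> 'm \<Rightarrow> bool" where
  "critical_point A f p \<longleftrightarrow> p \<in> carrier A \<and> (\<forall>v\<in>tangent_space A p. v f = 0)"

definition regular_part ::
    "('m::topological_space, 'e::euclidean_space) chart set \<Rightarrow> ('m \<Rightarrow> real) \<Rightarrow> 'm set" where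
  "regular_part A f = carrier A - {p. critical_point A f p}"

section \<open>Affine connections\<close>

(* An affine connection on the open submanifold W, in the sense of Koszul.  The axioms for
   U = W are the usual ones for an operator on the smooth vector fields on W.  As usual a
   connection is also applied to fields that are defined on a smaller open set only (coordinate
   fields, or fields on an open submanifold); these induced connections on the open subsets U
   are part of the data, and the second conjunct is their compatibility with restriction.
   Since vector fields are total functions, one operator serves all U. *)
definition affine_connection ::
    "('m::topological_space, 'e::euclidean_space) chart set \<Rightarrow> 'm set \<Rightarrow>
     ('m vfield \<Rightarrow> 'm vfield \<Rightarrow> 'm vfield) \<Rightarrow> bool" where
  "affine_connection A W nabla \<longleftrightarrow> open W \<and> W \<subseteq> carrier A \<and>
     (\<forall>U X Y. U \<subseteq> W \<and> smooth_vf A U X \<and> smooth_vf A U Y \<longrightarrow> smooth_vf A U (nabla X Y)) \<and>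
     (\<forall>U X X' Y Y'. U \<subseteq> W \<and> smooth_vf A U X \<and> smooth_vf A U X' \<and>
        smooth_vf A U Y \<and> smooth_vf A U Y' \<and> (\<forall>p\<in>U. X p = X' p \<and> Y p = Y' p) \<longrightarrow>
        (\<forall>p\<in>U. nabla X Y p = nabla X' Y' p)) \<and>
     (\<forall>U X X' Y h k. U \<subseteq> W \<and> smooth_vf A U X \<and> smooth_vf A U X' \<and> smooth_vf A U Y \<and>
        smooth_fun A U h \<and> smooth_fun A U k \<longrightarrow>
        (\<forall>p\<in>U. nabla (\<lambda>q w. h q * X q w + k q * X' q w) Y p =
           (\<lambda>w. h p * nabla X Y p w + k p * nabla X' Y p w))) \<and>
     (\<forall>U X Y Y'. U \<subseteq> W \<and> smooth_vf A U X \<and> smooth_vf A U Y \<and> smooth_vf A U Y' \<longrightarrow>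
        (\<forall>p\<in>U. nabla X (\<lambda>q w. Y q w + Y' q w) p = (\<lambda>w. nabla X Y p w + nabla X Y' p w))) \<and>
     (\<forall>U X Y h. U \<subseteq> W \<and> smooth_vf A U X \<and> smooth_vf A U Y \<and> smooth_fun A U h \<longrightarrow>
        (\<forall>p\<in>U. nabla X (\<lambda>q w. h q * Y q w) p = (\<lambda>w. X p h * Y p w + h p * nabla X Y p w)))"

definition torsion_free ::
    "('m::topological_space, 'e::euclidean_space) chart set \<Rightarrow> 'm set \<Rightarrow>
     ('m vfield \<Rightarrow> 'm vfield \<Rightarrow> 'm vfield) \<Rightarrow> bool" where
  "torsion_free A W nabla \<longleftrightarrow>
     (\<forall>U X Y. U \<subseteq> W \<and> smooth_vf A U X \<and> smooth_vf A U Y \<longrightarrow>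
        (\<forall>p\<in>U. (\<lambda>w. nabla X Y p w - nabla Y X p w) = lie_bracket A X Y p))"

definition metric_compatible ::
    "('m::topological_space, 'e::euclidean_space) chart set \<Rightarrow> 'm set \<Rightarrow> 'm metric \<Rightarrow>
     ('m vfield \<Rightarrow> 'm vfield \<Rightarrow> 'm vfield) \<Rightarrow> bool" where
  "metric_compatible A W g nabla \<longleftrightarrow>
     (\<forall>U X Y Z. U \<subseteq> W \<and> smooth_vf A U X \<and> smooth_vf A U Y \<and> smooth_vf A U Z \<longrightarrow>
        (\<forall>p\<in>U. X p (\<lambda>q. g q (Y q) (Z q)) =
           g p (nabla X Y p) (Z p) + g p (Y p) (nabla X Z p)))"

definition levi_civita ::
    "('m::topological_space, 'e::euclidean_space) chart set \<Rightarrow> 'm metric \<Rightarrow>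
     ('m vfield \<Rightarrow> 'm vfield \<Rightarrow> 'm vfield) \<Rightarrow> bool" where
  "levi_civita A g nabla \<longleftrightarrow> affine_connection A (carrier A) nabla \<and>
     torsion_free A (carrier A) nabla \<and> metric_compatible A (carrier A) g nabla"

section \<open>Covariant derivative along curves, pregeodesics, gradient curves\<close>

(* For c = (V, phi) and b a basis vector of the model space: the coordinate function x_b and the
   coordinate vector field d/dx_b on V. *)
definition coord_fun :: "('m, 'e::euclidean_space) chart \<Rightarrow> 'e \<Rightarrow> 'm \<Rightarrow> real" where
  "coord_fun c b q = snd c q \<bullet> b"

definition coord_field ::
    "('m::topological_space, 'e::euclidean_space) chart set \<Rightarrow> ('m, 'e) chart \<Rightarrow> 'e \<Rightarrow> 'm vfield" where
  "coord_field A c b p = (\<lambda>h. if smooth_near A p h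
     then frechet_derivative (h \<circ> inv_into (fst c) (snd c)) (at (snd c p)) b else 0)"

(* D V / dt = sum_b (V^b)' d/dx_b + sum_(a,b) (gamma^a)' V^b nabla_(d/dx_a) (d/dx_b)  at t,
   in a chart c around gamma t, for a vector field V along gamma; here V^b = V x_b. *)
definition cov_deriv_along ::
    "('m::topological_space, 'e::euclidean_space) chart set \<Rightarrow> ('m vfield \<Rightarrow> 'm vfield \<Rightarrow> 'm vfield) \<Rightarrow>
     ('m, 'e) chart \<Rightarrow> (real \<Rightarrow> 'm) \<Rightarrow> (real \<Rightarrow> 'm tangent) \<Rightarrow> real \<Rightarrow> 'm tangent" where
  "cov_deriv_along A nabla c \<gamma> V t = (\<lambda>w.
     (\<Sum>b\<in>Basis. deriv (\<lambda>s. V s (coord_fun c b)) t * coord_field A c b (\<gamma> t) w) +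
     (\<Sum>a\<in>Basis. \<Sum>b\<in>Basis. velocity A \<gamma> t (coord_fun c a) * V t (coord_fun c b) *
        nabla (coord_field A c a) (coord_field A c b) (\<gamma> t) w))"

(* A curve in W along which nabla_(gamma') gamma' = mu gamma' for a function mu.  The left-hand
   side does not depend on the chart.  Smoothness of mu is what makes gamma a reparametrized
   geodesic. *)
definition pregeodesic ::
    "('m::topological_space, 'e::euclidean_space) chart set \<Rightarrow> 'm set \<Rightarrow>
     ('m vfield \<Rightarrow> 'm vfield \<Rightarrow> 'm vfield) \<Rightarrow> real set \<Rightarrow> (real \<Rightarrow> 'm) \<Rightarrow> bool" where
  "pregeodesic A W nabla I \<gamma> \<longleftrightarrow> smooth_curve A I \<gamma> \<and> \<gamma> ` I \<subseteq> W \<and>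
     (\<exists>\<mu>. smooth_on I \<mu> \<and> (\<forall>t\<in>I. \<forall>c\<in>A. \<gamma> t \<in> fst c \<longrightarrow>
        cov_deriv_along A nabla c \<gamma> (velocity A \<gamma>) t = (\<lambda>w. \<mu> t * velocity A \<gamma> t w)))"

definition integral_curve ::
    "('m::topological_space, 'e::euclidean_space) chart set \<Rightarrow> 'm vfield \<Rightarrow>
     real set \<Rightarrow> (real \<Rightarrow> 'm) \<Rightarrow> bool" where
  "integral_curve A X I \<gamma> \<longleftrightarrow> smooth_curve A I \<gamma> \<and> (\<forall>t\<in>I. velocity A \<gamma> t = X (\<gamma> t))"

definition gradient_curve ::
    "('m::topological_space, 'e::euclidean_space) chart set \<Rightarrow> 'm metric \<Rightarrow> ('m \<Rightarrow> real) \<Rightarrow>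
     real set \<Rightarrow> (real \<Rightarrow> 'm) \<Rightarrow> bool" where
  "gradient_curve A g f I \<gamma> \<longleftrightarrow> \<gamma> ` I \<subseteq> regular_part A f \<and>
     (integral_curve A (gradient A g f) I \<gamma> \<or>
      integral_curve A (\<lambda>p w. - gradient A g f p w) I \<gamma>)"

end

theory Submission
  imports Defs
begin

text \<open>The modification subtracts from \<open>nabla\<close> a symmetric tensor with values in the smooth field
  \<open>T = (nabla G G - lam G) / |G|\<^sup>2\<close>, so it is again a torsion-free connection, and
  \<open>g(G, G) T\<close> is exactly what turns \<open>nabla G G\<close> into \<open>lam G\<close>. A gradient curve is an integral curve of
  \<open>G\<close> or \<open>- G\<close>, and along an integral curve of a field \<open>X\<close> the covariant derivative of the velocity
  is \<open>nabla X X\<close>, whatever the connection; both signs give \<open>lam G\<close>. The analytic point is that \<open>G\<close>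
  exists and is smooth: in a chart it is determined by its products with the coordinate fields.\<close>

section \<open>Calculus of smooth maps\<close>

text \<open>Vector fields are total functions that matter only on some open set, so every identity
  between fields has to be placed on an open set where all fields involved are smooth. Coordinate
  fields are smooth only on a chart domain; the computation along a curve therefore takes place on
  the intersection of that domain with the domain of the connection. A tangent vector is by
  definition the velocity of a curve, so closure under linear combinations is not evident. It comes
  from a chart, which presents the tangent space as a linear image of the model space; the same
  presentation gives the expansion in coordinate fields. Since tangent vectors vanish on functions
  not smooth near the point, these chart formulas hold for every argument. Division by
  \<open>g p (G p) (G p)\<close> confines \<open>T\<close> to the regular part: if \<open>G\<close>
  vanished at \<open>p\<close>, every \<open>v f = g p (G p) v\<close> would be zero. For the
  descending curves both slots change sign, so the result is still \<open>lam G\<close>, which is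
  \<open>(- lam) (- G)\<close>: the factor along the curve is \<open>- lam\<close> there.\<close>

lemma Ck_on_cong:
  assumes "open S" "Ck_on k S f" "\<And>x. x \<in> S \<Longrightarrow> f x = g x"
  shows "Ck_on k S g"
  using assms(2,3)
proof (induction k arbitrary: f g)
  case 0
  then show ?case using continuous_on_cong[of S S f g] by simp
next
  case (Suc k)
  have D: "(g has_derivative frechet_derivative f (at x)) (at x)" if "x \<in> S" for x
    using Suc.prems that assms(1)
    by (auto intro!: has_derivative_transform_within_open[of f _ x UNIV S g]
        simp: frechet_derivative_works)
  have "Ck_on k S (\<lambda>x. frechet_derivative g (at x) v)" for v
  proof (rule Suc.IH)
    show "Ck_on k S (\<lambda>x. frechet_derivative f (at x) v)" using Suc.prems by simp
    show "frechet_derivative f (at x) v = frechet_derivative g (at x) v" if "x \<in> S" for x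
      using frechet_derivative_at[OF D[OF that]] by simp
  qed
  with D show ?case by (auto simp: differentiable_def)
qed

text \<open>Derivatives are unique, so on the open set any known derivative formula may replace
  \<open>frechet_derivative\<close>. The closure rules below for sums, products, inverses and
  compositions all rest on this.\<close>

lemma Ck_on_derivI:
  assumes "open S"
    and D: "\<And>x. x \<in> S \<Longrightarrow> (f has_derivative f' x) (at x)"
    and "\<And>v. Ck_on k S (\<lambda>x. f' x v)"
  shows "Ck_on (Suc k) S f"
proof -
  have "f' x v = frechet_derivative f (at x) v" if "x \<in> S" for x v
    using frechet_derivative_at[OF D[OF that]] by simp
  then have "Ck_on k S (\<lambda>x. frechet_derivative f (at x) v)" for v
    by (rule Ck_on_cong[OF assms(1) assms(3)])
  with D show ?thesis by (auto simp: differentiable_def)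
qed

lemma Ck_on_has_derivative:
  "Ck_on (Suc k) S f \<Longrightarrow> x \<in> S \<Longrightarrow> (f has_derivative frechet_derivative f (at x)) (at x)"
  by (simp add: frechet_derivative_works)

lemma Ck_on_directional:
  "Ck_on (Suc k) S f \<Longrightarrow> Ck_on k S (\<lambda>x. frechet_derivative f (at x) v)"
  by simp

lemma Ck_on_SucD: "Ck_on (Suc k) S f \<Longrightarrow> Ck_on k S f"
proof (induction k arbitrary: f)
  case 0
  then show ?case
    by (auto intro!: continuous_at_imp_continuous_on differentiable_imp_continuous_within)
next
  case (Suc k)
  then show ?case by (metis Ck_on.simps(2))
qed

lemma Ck_on_subset: "Ck_on k S f \<Longrightarrow> T \<subseteq> S \<Longrightarrow> Ck_on k T f"
  by (induction k arbitrary: f) (auto intro: continuous_on_subset)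

text \<open>Continuity and differentiability are tested at each point inside the open
  \<open>T\<close>, so \<open>S\<close> itself may be any set.\<close>

lemma Ck_on_local:
  assumes "\<And>x. x \<in> S \<Longrightarrow> \<exists>T. open T \<and> x \<in> T \<and> Ck_on k T f"
  shows "Ck_on k S f"
  using assms
proof (induction k arbitrary: f)
  case 0
  have "isCont f x" if "x \<in> S" for x
    using 0[OF that] by (auto simp: continuous_on_eq_continuous_at)
  then show ?case by (simp add: continuous_at_imp_continuous_on)
next
  case (Suc k)
  have "f differentiable (at x)" if "x \<in> S" for x
    using Suc.prems[OF that] by auto
  moreover have "Ck_on k S (\<lambda>x. frechet_derivative f (at x) v)" for v
    by (rule Suc.IH) (use Suc.prems in fastforce)
  ultimately show ?case by simp
qed

lemma Ck_on_const: "Ck_on k S (\<lambda>x. c)"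
  by (induction k arbitrary: c) (simp_all add: frechet_derivative_const)

lemma Ck_on_bounded_linear:
  assumes "bounded_linear L" "open S" "Ck_on k S f"
  shows "Ck_on k S (\<lambda>x. L (f x))"
  using assms(3)
proof (induction k arbitrary: f)
  case 0
  then show ?case by (simp add: bounded_linear.continuous_on[OF assms(1)])
next
  case (Suc k)
  show ?case
    by (rule Ck_on_derivI[OF assms(2)
          bounded_linear.has_derivative[OF assms(1) Ck_on_has_derivative[OF Suc.prems]]
          Suc.IH[OF Ck_on_directional[OF Suc.prems]]])
qed

lemma Ck_on_add:
  assumes "open S" "Ck_on k S f" "Ck_on k S g"
  shows "Ck_on k S (\<lambda>x. f x + g x)"
  using assms(2,3)
proof (induction k arbitrary: f g)
  case 0
  then show ?case by (simp add: continuous_on_add)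
next
  case (Suc k)
  show ?case
    by (rule Ck_on_derivI[OF assms(1)
          has_derivative_add[OF Suc.prems[THEN Ck_on_has_derivative]]
          Suc.IH[OF Suc.prems[THEN Ck_on_directional]]])
qed

lemma Ck_on_sum:
  assumes "open S" "\<And>i. i \<in> I \<Longrightarrow> Ck_on k S (f i)"
  shows "Ck_on k S (\<lambda>x. \<Sum>i\<in>I. f i x)"
  using assms(2)
  by (induction I rule: infinite_finite_induct)
     (simp_all add: Ck_on_const Ck_on_add[OF assms(1)])

text \<open>The product rule pairs a derivative of one factor with the other factor itself, so the
  induction runs over all pairs and lowers the undifferentiated factor by
  \<open>Ck_on_SucD\<close>.\<close>

lemma Ck_on_scaleR:
  assumes "open S" "Ck_on k S (f :: _ \<Rightarrow> real)" "Ck_on k S g"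
  shows "Ck_on k S (\<lambda>x. f x *\<^sub>R g x)"
  using assms(2,3)
proof (induction k arbitrary: f g)
  case 0
  then show ?case by (simp add: continuous_on_scaleR)
next
  case (Suc k)
  show ?case
    by (rule Ck_on_derivI[OF assms(1)
          has_derivative_scaleR[OF Suc.prems[THEN Ck_on_has_derivative]]
          Ck_on_add[OF assms(1)
            Suc.IH[OF Ck_on_SucD[OF Suc.prems(1)] Ck_on_directional[OF Suc.prems(2)]]
            Suc.IH[OF Ck_on_directional[OF Suc.prems(1)] Ck_on_SucD[OF Suc.prems(2)]]]])
qed

lemma Ck_on_mult:
  "open S \<Longrightarrow> Ck_on k S f \<Longrightarrow> Ck_on k S g \<Longrightarrow> Ck_on k S (\<lambda>x. f x * g x :: real)"
  using Ck_on_scaleR[of S k f g] by simp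

text \<open>A bootstrap: the derivative is a product of directional derivatives of \<open>f\<close>
  with the inverse itself, which is already one order smooth enough by induction.\<close>

lemma Ck_on_inverse:
  fixes f :: "_ \<Rightarrow> real"
  assumes "open S" "Ck_on k S f" "\<And>x. x \<in> S \<Longrightarrow> f x \<noteq> 0"
  shows "Ck_on k S (\<lambda>x. inverse (f x))"
  using assms(2)
proof (induction k)
  case 0
  then show ?case using assms(3) by (simp add: continuous_on_inverse)
next
  case (Suc k)
  let ?D = "\<lambda>x. frechet_derivative f (at x)"
  have I: "Ck_on k S (\<lambda>x. inverse (f x))"
    by (rule Suc.IH[OF Ck_on_SucD[OF Suc.prems]])
  show ?case
  proof (rule Ck_on_derivI[OF assms(1)])
    show "((\<lambda>x. inverse (f x)) has_derivative
        (\<lambda>v. (- 1) * (inverse (f x) * ?D x v * inverse (f x)))) (at x)" if "x \<in> S" for x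
      using Deriv.has_derivative_inverse[OF assms(3)[OF that] Ck_on_has_derivative[OF Suc.prems that]]
      by simp
    show "Ck_on k S (\<lambda>x. (- 1) * (inverse (f x) * ?D x v * inverse (f x)))" for v
      by (intro Ck_on_mult assms(1) I Ck_on_directional[OF Suc.prems] Ck_on_const)
  qed
qed

text \<open>In the chain rule the direction fed to the derivative of \<open>h\<close> varies with
  the point, whereas \<open>Ck_on\<close> speaks of fixed directions. Expanding that direction in
  the basis of the Euclidean space leaves products of fixed directional derivatives, composed with
  \<open>c\<close>, and components of the derivative of \<open>c\<close>.\<close>

lemma Ck_on_compose:
  fixes c :: "'a::real_normed_vector \<Rightarrow> 'e::euclidean_space"
  assumes "open S" "open T" "Ck_on k T h" "Ck_on k S c" "c ` S \<subseteq> T"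
  shows "Ck_on k S (\<lambda>x. h (c x))"
  using assms(3,4)
proof (induction k arbitrary: h)
  case 0
  then show ?case using assms(5)
    by (auto intro: continuous_on_compose2)
next
  case (Suc k)
  let ?D = "\<lambda>y. frechet_derivative h (at y)" and ?E = "\<lambda>x. frechet_derivative c (at x)"
  show ?case
  proof (rule Ck_on_derivI[OF assms(1)])
    fix x assume x: "x \<in> S"
    then have "c x \<in> T" using assms(5) by blast
    note dh = Ck_on_has_derivative[OF Suc.prems(1) this]
    have "((\<lambda>x. h (c x)) has_derivative (\<lambda>v. ?D (c x) (?E x v))) (at x)"
      by (rule has_derivative_compose[OF Ck_on_has_derivative[OF Suc.prems(2) x] dh])
    moreover have "?D (c x) u = (\<Sum>b\<in>Basis. (u \<bullet> b) *\<^sub>R ?D (c x) b)" for u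
    proof -
      have "linear (?D (c x))" using dh has_derivative_linear by blast
      then have "(\<Sum>b\<in>Basis. (u \<bullet> b) *\<^sub>R ?D (c x) b) = ?D (c x) (\<Sum>b\<in>Basis. (u \<bullet> b) *\<^sub>R b)"
        by (simp add: linear_sum linear_scale)
      then show ?thesis by (simp add: euclidean_representation)
    qed
    ultimately show "((\<lambda>x. h (c x)) has_derivative
        (\<lambda>v. \<Sum>b\<in>Basis. (?E x v \<bullet> b) *\<^sub>R ?D (c x) b)) (at x)"
      by (metis (no_types, lifting) ext)
  next
    fix v
    have "Ck_on k S (\<lambda>x. ?E x v \<bullet> b)" for b
      by (rule Ck_on_bounded_linear[OF bounded_linear_inner_left assms(1)
            Ck_on_directional[OF Suc.prems(2)]])
    moreover have "Ck_on k S (\<lambda>x. ?D (c x) b)" for b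
      by (rule Suc.IH[OF Ck_on_directional[OF Suc.prems(1)] Ck_on_SucD[OF Suc.prems(2)]])
    ultimately show "Ck_on k S (\<lambda>x. \<Sum>b\<in>Basis. (?E x v \<bullet> b) *\<^sub>R ?D (c x) b)"
      by (intro Ck_on_sum Ck_on_scaleR assms(1))
  qed
qed

section \<open>Closure rules for smooth maps, taken order by order from \<open>Ck_on\<close>\<close>

lemma smooth_on_cong:
  "open S \<Longrightarrow> smooth_on S f \<Longrightarrow> (\<And>x. x \<in> S \<Longrightarrow> f x = g x) \<Longrightarrow> smooth_on S g"
  unfolding smooth_on_def using Ck_on_cong by blast

lemma smooth_on_subset: "smooth_on S f \<Longrightarrow> T \<subseteq> S \<Longrightarrow> smooth_on T f"
  unfolding smooth_on_def using Ck_on_subset by blast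

lemma smooth_on_local:
  "(\<And>x. x \<in> S \<Longrightarrow> \<exists>T. open T \<and> x \<in> T \<and> smooth_on T f) \<Longrightarrow> smooth_on S f"
  unfolding smooth_on_def by (meson Ck_on_local)

lemma smooth_on_const: "smooth_on S (\<lambda>x. c)"
  unfolding smooth_on_def by (simp add: Ck_on_const)

lemma smooth_on_bounded_linear:
  "bounded_linear L \<Longrightarrow> open S \<Longrightarrow> smooth_on S f \<Longrightarrow> smooth_on S (\<lambda>x. L (f x))"
  unfolding smooth_on_def using Ck_on_bounded_linear by blast

lemma smooth_on_add:
  "open S \<Longrightarrow> smooth_on S f \<Longrightarrow> smooth_on S g \<Longrightarrow> smooth_on S (\<lambda>x. f x + g x)"
  unfolding smooth_on_def using Ck_on_add by blast

lemma smooth_on_mult: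
  "open S \<Longrightarrow> smooth_on S f \<Longrightarrow> smooth_on S g \<Longrightarrow> smooth_on S (\<lambda>x. f x * g x :: real)"
  unfolding smooth_on_def using Ck_on_mult by blast

lemma smooth_on_inverse:
  "open S \<Longrightarrow> smooth_on S f \<Longrightarrow> (\<And>x. x \<in> S \<Longrightarrow> f x \<noteq> (0::real)) \<Longrightarrow>
    smooth_on S (\<lambda>x. inverse (f x))"
  unfolding smooth_on_def using Ck_on_inverse by blast

lemma smooth_on_compose:
  fixes c :: "'a::real_normed_vector \<Rightarrow> 'e::euclidean_space"
  shows "open S \<Longrightarrow> open T \<Longrightarrow> smooth_on T h \<Longrightarrow> smooth_on S c \<Longrightarrow> c ` S \<subseteq> T \<Longrightarrow>
    smooth_on S (\<lambda>x. h (c x))"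
  unfolding smooth_on_def using Ck_on_compose by blast

lemma smooth_on_directional:
  "smooth_on S f \<Longrightarrow> smooth_on S (\<lambda>x. frechet_derivative f (at x) v)"
  unfolding smooth_on_def by (blast intro: Ck_on_directional)

lemma smooth_on_has_derivative:
  "smooth_on S f \<Longrightarrow> x \<in> S \<Longrightarrow> (f has_derivative frechet_derivative f (at x)) (at x)"
  unfolding smooth_on_def by (meson Ck_on_has_derivative)

lemma smooth_on_ident: "smooth_on S (\<lambda>x. x)"
proof -
  have "Ck_on k S (\<lambda>x. x)" for k
    by (cases k) (simp_all add: frechet_derivative_ident Ck_on_const)
  then show ?thesis by (simp add: smooth_on_def)
qed

section \<open>Functions, tangent vectors and vector fields in charts\<close>

locale manifold =
  fixes A :: "('m::{t2_space,second_countable_topology}, 'e::euclidean_space) chart set"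
  assumes smooth_manifold: "smooth_manifold A"
begin

lemma
  assumes "(V, \<phi>) \<in> A"
  shows open_chart: "open V"
    and open_chart_range: "open (\<phi> ` V)"
    and chart_homeomorphism: "homeomorphism V (\<phi> ` V) \<phi> (inv_into V \<phi>)"
  using smooth_manifold assms unfolding smooth_manifold_def is_chart_def by force+

lemma transition_smooth:
  "(V, \<phi>) \<in> A \<Longrightarrow> (V', \<phi>') \<in> A \<Longrightarrow> smooth_on (\<phi> ` (V \<inter> V')) (\<phi>' \<circ> inv_into V \<phi>)"
  using smooth_manifold unfolding smooth_manifold_def by fast

lemma chart_inv: "(V, \<phi>) \<in> A \<Longrightarrow> p \<in> V \<Longrightarrow> inv_into V \<phi> (\<phi> p) = p"
  using chart_homeomorphism homeomorphism_apply1 by blast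

lemma open_chart_image:
  assumes "(V, \<phi>) \<in> A" "open U" "U \<subseteq> V"
  shows "open (\<phi> ` U)"
proof -
  have "openin (top_of_set V) U" using assms by (simp add: open_subset)
  then show ?thesis
    using homeomorphism_imp_open_map[OF chart_homeomorphism[OF assms(1)]]
      open_chart_range[OF assms(1)] openin_open_trans by blast
qed

lemma chart_subset_carrier: "(V, \<phi>) \<in> A \<Longrightarrow> V \<subseteq> carrier A"
  unfolding carrier_def by fast

lemma carrier_chart:
  assumes "p \<in> carrier A"
  obtains V \<phi> where "(V, \<phi>) \<in> A" "p \<in> V"
  using assms unfolding carrier_def by blast

section \<open>Smooth functions on the manifold\<close>

lemma smooth_fun_chart:
  "smooth_fun A U h \<Longrightarrow> (V, \<phi>) \<in> A \<Longrightarrow> smooth_on (\<phi> ` (U \<inter> V)) (h \<circ> inv_into V \<phi>)"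
  unfolding smooth_fun_def by fast

lemma smooth_fun_open: "smooth_fun A U h \<Longrightarrow> open U"
  and smooth_fun_carrier: "smooth_fun A U h \<Longrightarrow> U \<subseteq> carrier A"
  unfolding smooth_fun_def by auto

text \<open>One chart around each point suffices: in any other chart the representative of
  \<open>h\<close> is locally the given one composed with a smooth transition map.\<close>

lemma smooth_funI:
  assumes "open U"
    and *: "\<And>p. p \<in> U \<Longrightarrow> \<exists>V \<phi> W. (V, \<phi>) \<in> A \<and> open W \<and> p \<in> W \<and> W \<subseteq> V \<and>
      smooth_on (\<phi> ` W) (h \<circ> inv_into V \<phi>)"
  shows "smooth_fun A U h"
  unfolding smooth_fun_def
proof (intro conjI assms(1) ballI, goal_cases)
  case 1
  then show ?case using * chart_subset_carrier by blast
next
  case (2 c)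
  obtain V' \<phi>' where c: "c = (V', \<phi>')" by force
  with 2 have c': "(V', \<phi>') \<in> A" by simp
  have "smooth_on (\<phi>' ` (U \<inter> V')) (h \<circ> inv_into V' \<phi>')"
  proof (rule smooth_on_local)
    fix y assume "y \<in> \<phi>' ` (U \<inter> V')"
    then obtain p where p: "p \<in> U" "p \<in> V'" "y = \<phi>' p" by blast
    obtain V \<phi> W where W: "(V, \<phi>) \<in> A" "open W" "p \<in> W" "W \<subseteq> V"
        "smooth_on (\<phi> ` W) (h \<circ> inv_into V \<phi>)"
      using *[OF p(1)] by blast
    let ?T = "\<phi>' ` (W \<inter> V')"
    have T: "open ?T"
      using c' W(2) open_chart[OF c'] by (intro open_chart_image) auto
    have "smooth_on ?T (\<phi> \<circ> inv_into V' \<phi>')"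
      by (rule smooth_on_subset[OF transition_smooth[OF c' W(1)]]) (use W(4) in blast)
    moreover have "(\<phi> \<circ> inv_into V' \<phi>') ` ?T \<subseteq> \<phi> ` W"
      using chart_inv[OF c'] by auto
    ultimately have "smooth_on ?T (\<lambda>x. (h \<circ> inv_into V \<phi>) ((\<phi> \<circ> inv_into V' \<phi>') x))"
      using smooth_on_compose[OF T open_chart_image[OF W(1,2,4)] W(5)] by blast
    then have "smooth_on ?T (h \<circ> inv_into V' \<phi>')"
      by (rule smooth_on_cong[OF T])
         (use chart_inv[OF c'] chart_inv[OF W(1)] W(4) in auto)
    then show "\<exists>T. open T \<and> y \<in> T \<and> smooth_on T (h \<circ> inv_into V' \<phi>')"
      using T p W(3) by blast
  qed
  then show ?case by (simp add: c)
qed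

text \<open>Packages the openness of the chart image, on which the calculus rules depend.\<close>

lemma smooth_fun_pointwise:
  assumes "open U" "U \<subseteq> carrier A"
    and "\<And>V \<phi>. (V, \<phi>) \<in> A \<Longrightarrow> open (\<phi> ` (U \<inter> V)) \<Longrightarrow>
      smooth_on (\<phi> ` (U \<inter> V)) (h \<circ> inv_into V \<phi>)"
  shows "smooth_fun A U h"
  unfolding smooth_fun_def
proof (intro conjI assms ballI)
  fix c assume "c \<in> A"
  then obtain V \<phi> where c: "c = (V, \<phi>)" "(V, \<phi>) \<in> A" by (cases c) auto
  have "open (\<phi> ` (U \<inter> V))"
    using open_chart_image[OF c(2) open_Int[OF assms(1) open_chart[OF c(2)]]] by blast
  then show "case c of (V, \<phi>) \<Rightarrow> smooth_on (\<phi> ` (U \<inter> V)) (h \<circ> inv_into V \<phi>)"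
    using assms(3) c by simp
qed

lemma smooth_fun_restrict:
  assumes "smooth_fun A U h" "open U'" "U' \<subseteq> U"
  shows "smooth_fun A U' h"
proof (rule smooth_fun_pointwise[OF assms(2)])
  show "U' \<subseteq> carrier A" using assms(3) smooth_fun_carrier[OF assms(1)] by blast
  show "smooth_on (\<phi> ` (U' \<inter> V)) (h \<circ> inv_into V \<phi>)" if "(V, \<phi>) \<in> A" for V \<phi>
    by (rule smooth_on_subset[OF smooth_fun_chart[OF assms(1) that]]) (use assms(3) in blast)
qed

lemma smooth_fun_cong:
  assumes "smooth_fun A U h" "\<And>p. p \<in> U \<Longrightarrow> h p = k p"
  shows "smooth_fun A U k"
proof (rule smooth_fun_pointwise[OF smooth_fun_open[OF assms(1)] smooth_fun_carrier[OF assms(1)]])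
  fix V \<phi> assume c: "(V, \<phi>) \<in> A" and o: "open (\<phi> ` (U \<inter> V))"
  show "smooth_on (\<phi> ` (U \<inter> V)) (k \<circ> inv_into V \<phi>)"
    by (rule smooth_on_cong[OF o smooth_fun_chart[OF assms(1) c]])
       (use chart_inv[OF c] assms(2) in auto)
qed

lemma smooth_fun_local:
  assumes "\<And>p. p \<in> U \<Longrightarrow> \<exists>W. p \<in> W \<and> W \<subseteq> U \<and> smooth_fun A W h"
  shows "smooth_fun A U h"
proof (rule smooth_funI)
  show "open U" using assms smooth_fun_open by (subst open_subopen) blast
  fix p assume "p \<in> U"
  then obtain W where W: "p \<in> W" "smooth_fun A W h" using assms by blast
  then obtain V \<phi> where c: "(V, \<phi>) \<in> A" "p \<in> V"
    using smooth_fun_carrier carrier_chart by blast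
  show "\<exists>V \<phi> W. (V, \<phi>) \<in> A \<and> open W \<and> p \<in> W \<and> W \<subseteq> V \<and>
      smooth_on (\<phi> ` W) (h \<circ> inv_into V \<phi>)"
    using c W open_chart[OF c(1)] smooth_fun_open[OF W(2)] smooth_fun_chart[OF W(2) c(1)]
    by (intro exI[of _ V] exI[of _ \<phi>] exI[of _ "W \<inter> V"]) auto
qed

lemma smooth_fun_const: "open U \<Longrightarrow> U \<subseteq> carrier A \<Longrightarrow> smooth_fun A U (\<lambda>p. c)"
  by (rule smooth_fun_pointwise) (simp_all add: o_def smooth_on_const)

lemma smooth_fun_add:
  assumes "smooth_fun A U h" "smooth_fun A U k"
  shows "smooth_fun A U (\<lambda>p. h p + k p)"
proof (rule smooth_fun_pointwise[OF smooth_fun_open[OF assms(1)] smooth_fun_carrier[OF assms(1)]])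
  fix V \<phi> assume c: "(V, \<phi>) \<in> A" and o: "open (\<phi> ` (U \<inter> V))"
  show "smooth_on (\<phi> ` (U \<inter> V)) ((\<lambda>p. h p + k p) \<circ> inv_into V \<phi>)"
    using smooth_on_add[OF o smooth_fun_chart[OF assms(1) c] smooth_fun_chart[OF assms(2) c]]
    by (simp add: o_def)
qed

lemma smooth_fun_mult:
  assumes "smooth_fun A U h" "smooth_fun A U k"
  shows "smooth_fun A U (\<lambda>p. h p * k p)"
proof (rule smooth_fun_pointwise[OF smooth_fun_open[OF assms(1)] smooth_fun_carrier[OF assms(1)]])
  fix V \<phi> assume c: "(V, \<phi>) \<in> A" and o: "open (\<phi> ` (U \<inter> V))"
  show "smooth_on (\<phi> ` (U \<inter> V)) ((\<lambda>p. h p * k p) \<circ> inv_into V \<phi>)"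
    using smooth_on_mult[OF o smooth_fun_chart[OF assms(1) c] smooth_fun_chart[OF assms(2) c]]
    by (simp add: o_def)
qed

lemma smooth_fun_inverse:
  assumes "smooth_fun A U h" "\<And>p. p \<in> U \<Longrightarrow> h p \<noteq> 0"
  shows "smooth_fun A U (\<lambda>p. inverse (h p))"
proof (rule smooth_fun_pointwise[OF smooth_fun_open[OF assms(1)] smooth_fun_carrier[OF assms(1)]])
  fix V \<phi> assume c: "(V, \<phi>) \<in> A" and o: "open (\<phi> ` (U \<inter> V))"
  show "smooth_on (\<phi> ` (U \<inter> V)) ((\<lambda>p. inverse (h p)) \<circ> inv_into V \<phi>)"
    using smooth_on_inverse[OF o smooth_fun_chart[OF assms(1) c]] chart_inv[OF c] assms(2)
    by (fastforce simp: o_def)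
qed

lemma smooth_fun_near: "smooth_fun A U h \<Longrightarrow> p \<in> U \<Longrightarrow> smooth_near A p h"
  unfolding smooth_near_def by blast

lemma smooth_near_has_derivative:
  assumes "smooth_near A p h" "(V, \<phi>) \<in> A" "p \<in> V"
  shows "((h \<circ> inv_into V \<phi>) has_derivative
    frechet_derivative (h \<circ> inv_into V \<phi>) (at (\<phi> p))) (at (\<phi> p))"
  using assms smooth_on_has_derivative[OF smooth_fun_chart] unfolding smooth_near_def by blast

lemma coord_fun_smooth:
  assumes "(V, \<phi>) \<in> A"
  shows "smooth_fun A V (coord_fun (V, \<phi>) b)"
proof (rule smooth_fun_pointwise[OF open_chart[OF assms] chart_subset_carrier[OF assms]])
  fix V' \<phi>' assume c: "(V', \<phi>') \<in> A" and o: "open (\<phi>' ` (V \<inter> V'))"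
  have "smooth_on (\<phi>' ` (V \<inter> V')) (\<phi> \<circ> inv_into V' \<phi>')"
    using transition_smooth[OF c assms] by (simp add: Int_commute)
  from smooth_on_bounded_linear[OF bounded_linear_inner_left[of b] o this]
  show "smooth_on (\<phi>' ` (V \<inter> V')) (coord_fun (V, \<phi>) b \<circ> inv_into V' \<phi>')"
    by (simp add: coord_fun_def o_def)
qed

section \<open>Smooth curves and tangent vectors in a chart\<close>

lemma smooth_curve_preimage_open:
  assumes "smooth_curve A I \<gamma>" "open V"
  shows "open {t \<in> I. \<gamma> t \<in> V}"
proof -
  have "open (I \<inter> \<gamma> -` V)"
    using assms continuous_open_preimage unfolding smooth_curve_def by blast
  moreover have "I \<inter> \<gamma> -` V = {t \<in> I. \<gamma> t \<in> V}" by blast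
  ultimately show ?thesis by simp
qed

lemma smooth_curve_chart:
  "smooth_curve A I \<gamma> \<Longrightarrow> (V, \<phi>) \<in> A \<Longrightarrow> smooth_on {t \<in> I. \<gamma> t \<in> V} (\<phi> \<circ> \<gamma>)"
  unfolding smooth_curve_def by fast

text \<open>Supplies the smoothness of the factor in \<open>pregeodesic\<close>.\<close>

lemma smooth_fun_compose_curve:
  assumes "smooth_curve A I \<gamma>" "smooth_fun A U h" "\<gamma> ` I \<subseteq> U"
  shows "smooth_on I (\<lambda>t. h (\<gamma> t))"
proof (rule smooth_on_local)
  fix t assume t: "t \<in> I"
  then obtain V \<phi> where c: "(V, \<phi>) \<in> A" "\<gamma> t \<in> V"
    using assms smooth_fun_carrier carrier_chart by blast
  let ?T = "{t \<in> I. \<gamma> t \<in> V}"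
  have T: "open ?T" by (rule smooth_curve_preimage_open[OF assms(1) open_chart[OF c(1)]])
  have "open (\<phi> ` (U \<inter> V))"
    using open_chart[OF c(1)] smooth_fun_open[OF assms(2)] open_chart_image[OF c(1)] by auto
  then have "smooth_on ?T (\<lambda>x. (h \<circ> inv_into V \<phi>) ((\<phi> \<circ> \<gamma>) x))"
    by (rule smooth_on_compose[OF T _ smooth_fun_chart[OF assms(2) c(1)]
          smooth_curve_chart[OF assms(1) c(1)]]) (use assms(3) in auto)
  then have "smooth_on ?T (\<lambda>t. h (\<gamma> t))"
    by (rule smooth_on_cong[OF T]) (simp add: chart_inv[OF c(1)])
  with T t c(2) show "\<exists>T. open T \<and> t \<in> T \<and> smooth_on T (\<lambda>t. h (\<gamma> t))" by blast
qed

text \<open>The chain rule for \<open>h\<close> in the chart composed with the curve in the chart.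
  Both sides are zero on functions not smooth near the point, so they agree as HOL
  functions.\<close>

lemma velocity_chart:
  assumes "smooth_curve A I \<gamma>" "t \<in> I" "(V, \<phi>) \<in> A" "\<gamma> t \<in> V"
  shows "velocity A \<gamma> t = coord_field A (V, \<phi>) (frechet_derivative (\<phi> \<circ> \<gamma>) (at t) 1) (\<gamma> t)"
proof
  fix h :: "'m \<Rightarrow> real"
  let ?E = "frechet_derivative (\<phi> \<circ> \<gamma>) (at t)"
  let ?F = "frechet_derivative (h \<circ> inv_into V \<phi>) (at (\<phi> (\<gamma> t)))"
  let ?T = "{t \<in> I. \<gamma> t \<in> V}"
  have E: "((\<phi> \<circ> \<gamma>) has_derivative ?E) (at t)"
    using smooth_on_has_derivative[OF smooth_curve_chart] assms by blast
  have "deriv (\<lambda>s. h (\<gamma> s)) t = ?F (?E 1)" if "smooth_near A (\<gamma> t) h"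
  proof -
    have "((\<lambda>s. (h \<circ> inv_into V \<phi>) ((\<phi> \<circ> \<gamma>) s)) has_derivative (\<lambda>r. ?F (?E r))) (at t)"
      by (rule has_derivative_compose[OF E])
         (use smooth_near_has_derivative[OF that assms(3,4)] in \<open>simp add: o_def\<close>)
    then have D: "((\<lambda>s. h (\<gamma> s)) has_derivative (\<lambda>r. ?F (?E r))) (at t)"
      by (rule has_derivative_transform_within_open
            [OF _ smooth_curve_preimage_open[OF assms(1) open_chart[OF assms(3)]]])
         (use assms(2,4) in simp, simp add: chart_inv[OF assms(3)])
    \<comment> \<open>A linear map of the reals is multiplication by its value at 1; this turns the
      Frechet derivative into the number that \<open>deriv\<close> denotes.\<close>
    obtain k where k: "(\<lambda>r. ?F (?E r)) = (*) k"
      by (rule real_linearD[OF has_derivative_linear[OF D]])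
    then have "?F (?E 1) = k" using fun_cong[OF k, of 1] by simp
    with D k show ?thesis
      by (intro DERIV_imp_deriv) (simp add: has_field_derivative_def)
  qed
  then show "velocity A \<gamma> t h = coord_field A (V, \<phi>) (?E 1) (\<gamma> t) h"
    by (simp add: velocity_def coord_field_def)
qed

text \<open>The required curve is the straight line through \<open>\<phi> p\<close> in direction
  \<open>u\<close>, pulled back by the chart and run for so short a time that it stays in the chart
  image.\<close>

lemma coord_field_in_tangent_space:
  assumes c: "(V, \<phi>) \<in> A" and p: "p \<in> V"
  shows "coord_field A (V, \<phi>) u p \<in> tangent_space A p"
proof -
  obtain e where e: "e > 0" "ball (\<phi> p) e \<subseteq> \<phi> ` V"
    using open_chart_range[OF c] p open_contains_ball by blast
  \<comment> \<open>The summand 1 covers \<open>u = 0\<close>; for times below this bound the line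
    moves by less than \<open>e\<close>.\<close>
  define \<epsilon> where "\<epsilon> = e / (norm u + 1)"
  define l where "l = (\<lambda>t. \<phi> p + t *\<^sub>R u)"
  define \<gamma> where "\<gamma> = inv_into V \<phi> \<circ> l"
  let ?I = "{-\<epsilon><..<\<epsilon>}"
  have \<epsilon>: "\<epsilon> > 0" unfolding \<epsilon>_def using e(1) by (simp add: add_nonneg_pos)
  have l: "l t \<in> \<phi> ` V" if "t \<in> ?I" for t
  proof -
    have "\<bar>t\<bar> < e / (norm u + 1)" using that unfolding \<epsilon>_def by auto
    then have "\<bar>t\<bar> * (norm u + 1) < e"
      using pos_less_divide_eq[of "norm u + 1" "\<bar>t\<bar>" e] norm_ge_zero[of u] by linarith
    moreover have "\<bar>t\<bar> * norm u \<le> \<bar>t\<bar> * (norm u + 1)" by (simp add: mult_left_mono)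
    ultimately have "\<bar>t\<bar> * norm u < e" by linarith
    then have "l t \<in> ball (\<phi> p) e" by (simp add: l_def dist_norm)
    with e(2) show ?thesis by blast
  qed
  have \<gamma>: "\<gamma> t \<in> V" "\<phi> (\<gamma> t) = l t" if "t \<in> ?I" for t
    using inv_into_into[OF l[OF that]] f_inv_into_f[OF l[OF that]] by (simp_all add: \<gamma>_def)
  have l_smooth: "smooth_on UNIV l"
    unfolding l_def
    by (intro smooth_on_add smooth_on_const smooth_on_bounded_linear[of "\<lambda>t. t *\<^sub>R u"]
        bounded_linear_scaleR_left smooth_on_ident open_UNIV)
  have curve: "smooth_curve A ?I \<gamma>"
    unfolding smooth_curve_def
  proof (intro conjI ballI)
    show c\<gamma>: "continuous_on ?I \<gamma>"
      unfolding \<gamma>_def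
    proof (rule continuous_on_compose)
      show "continuous_on ?I l" unfolding l_def by (intro continuous_intros)
      show "continuous_on (l ` ?I) (inv_into V \<phi>)"
        using l homeomorphism_cont2[OF chart_homeomorphism[OF c]] continuous_on_subset by blast
    qed
    show "\<gamma> ` ?I \<subseteq> carrier A" using \<gamma> chart_subset_carrier[OF c] by blast
    fix d assume "d \<in> A"
    then obtain V' \<phi>' where d: "d = (V', \<phi>')" "(V', \<phi>') \<in> A" by (cases d) auto
    let ?T = "{t \<in> ?I. \<gamma> t \<in> V'}"
    have T: "open ?T"
      using continuous_open_preimage[OF c\<gamma> _ open_chart[OF d(2)]]
      by (simp add: Int_def vimage_def)
    have lT: "l ` ?T \<subseteq> \<phi> ` (V \<inter> V')" using \<gamma> by (force simp flip: \<gamma>(2))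
    have "open (\<phi> ` (V \<inter> V'))"
      using open_chart[OF c] open_chart[OF d(2)] open_chart_image[OF c] by auto
    from smooth_on_compose[OF T this transition_smooth[OF c d(2)] smooth_on_subset[OF l_smooth] lT]
    have "smooth_on ?T (\<phi>' \<circ> \<gamma>)" by (simp add: \<gamma>_def o_def)
    then show "case d of (V, \<phi>) \<Rightarrow> smooth_on {t \<in> ?I. \<gamma> t \<in> V} (\<phi> \<circ> \<gamma>)"
      by (simp add: d(1))
  qed (auto simp: is_interval_oo)
  have \<gamma>0: "\<gamma> 0 = p" unfolding \<gamma>_def l_def using chart_inv[OF c p] by simp
  have "(l has_derivative (\<lambda>t. t *\<^sub>R u)) (at 0)"
    unfolding l_def by (auto intro!: derivative_eq_intros)
  then have "((\<phi> \<circ> \<gamma>) has_derivative (\<lambda>t. t *\<^sub>R u)) (at 0)"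
    by (rule has_derivative_transform_within_open[of _ _ _ _ ?I]) (use \<epsilon> \<gamma> in auto)
  then have "frechet_derivative (\<phi> \<circ> \<gamma>) (at 0) 1 = u"
    using frechet_derivative_at by (metis scaleR_one)
  then have "velocity A \<gamma> 0 = coord_field A (V, \<phi>) u p"
    using velocity_chart[OF curve _ c] \<epsilon> \<gamma>0 p by simp
  then show ?thesis
    unfolding tangent_space_def using curve \<epsilon> \<gamma>0 by (auto intro!: exI[of _ \<gamma>])
qed

lemma tangent_space_chart:
  assumes "(V, \<phi>) \<in> A" "p \<in> V"
  shows "tangent_space A p = range (\<lambda>u. coord_field A (V, \<phi>) u p)"
proof
  show "tangent_space A p \<subseteq> range (\<lambda>u. coord_field A (V, \<phi>) u p)"
  proof
    fix v assume "v \<in> tangent_space A p"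
    then obtain \<gamma> \<epsilon> where "v = velocity A \<gamma> 0" "\<epsilon> > 0" "smooth_curve A {-\<epsilon><..<\<epsilon>} \<gamma>" "\<gamma> 0 = p"
      unfolding tangent_space_def by blast
    then show "v \<in> range (\<lambda>u. coord_field A (V, \<phi>) u p)"
      using velocity_chart[of "{-\<epsilon><..<\<epsilon>}" \<gamma> 0] assms by force
  qed
  show "range (\<lambda>u. coord_field A (V, \<phi>) u p) \<subseteq> tangent_space A p"
    using coord_field_in_tangent_space[OF assms] by blast
qed

lemma coord_field_linear:
  assumes "(V, \<phi>) \<in> A" "p \<in> V"
  shows "linear (\<lambda>u. coord_field A (V, \<phi>) u p h)"
proof (cases "smooth_near A p h")
  case True
  then show ?thesis
    using has_derivative_linear[OF smooth_near_has_derivative[OF True assms]]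
    by (simp add: coord_field_def)
next
  case False
  then show ?thesis by (simp add: coord_field_def linear_zero)
qed

text \<open>Duality of coordinate fields and coordinate functions: it reads off the components of a
  tangent vector.\<close>

lemma coord_field_coord_fun:
  assumes "(V, \<phi>) \<in> A" "p \<in> V"
  shows "coord_field A (V, \<phi>) u p (coord_fun (V, \<phi>) b) = u \<bullet> b"
proof -
  have "((\<lambda>y. y \<bullet> b) has_derivative (\<lambda>u. u \<bullet> b)) (at (\<phi> p))"
    by (rule bounded_linear_imp_has_derivative[OF bounded_linear_inner_left])
  then have "((coord_fun (V, \<phi>) b \<circ> inv_into V \<phi>) has_derivative (\<lambda>u. u \<bullet> b)) (at (\<phi> p))"
    by (rule has_derivative_transform_within_open[OF _ open_chart_range[OF assms(1)]])
       (use assms chart_inv[OF assms(1)] in \<open>auto simp: coord_fun_def\<close>)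
  then have "frechet_derivative (coord_fun (V, \<phi>) b \<circ> inv_into V \<phi>) (at (\<phi> p)) = (\<lambda>u. u \<bullet> b)"
    using frechet_derivative_at by metis
  then show ?thesis
    using smooth_fun_near[OF coord_fun_smooth] assms by (simp add: coord_field_def)
qed

lemma tangent_expansion:
  assumes "(V, \<phi>) \<in> A" "p \<in> V" "v \<in> tangent_space A p"
  shows "v h = (\<Sum>b\<in>Basis. v (coord_fun (V, \<phi>) b) * coord_field A (V, \<phi>) b p h)"
proof -
  obtain u where u: "v = coord_field A (V, \<phi>) u p"
    using assms tangent_space_chart by blast
  have "v h = coord_field A (V, \<phi>) (\<Sum>b\<in>Basis. (u \<bullet> b) *\<^sub>R b) p h"
    by (simp add: u euclidean_representation)
  also have "\<dots> = (\<Sum>b\<in>Basis. (u \<bullet> b) * coord_field A (V, \<phi>) b p h)"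
    using linear_sum[OF coord_field_linear[OF assms(1,2)], of "\<lambda>b. (u \<bullet> b) *\<^sub>R b" Basis]
      linear_scale[OF coord_field_linear[OF assms(1,2)]] by simp
  finally show ?thesis
    by (simp add: u coord_field_coord_fun[OF assms(1,2)])
qed

text \<open>Curves cannot be added, but their directions in a chart can, and the line in the
  combined direction realizes the sum.\<close>

lemma tangent_lincomb:
  assumes "p \<in> carrier A" "v \<in> tangent_space A p" "w \<in> tangent_space A p"
  shows "(\<lambda>h. r * v h + s * w h) \<in> tangent_space A p"
proof -
  obtain V \<phi> where c: "(V, \<phi>) \<in> A" "p \<in> V" using assms(1) carrier_chart by blast
  obtain x y where "v = coord_field A (V, \<phi>) x p" "w = coord_field A (V, \<phi>) y p"
    using assms tangent_space_chart[OF c] by blast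
  then have "(\<lambda>h. r * v h + s * w h) = coord_field A (V, \<phi>) (r *\<^sub>R x + s *\<^sub>R y) p"
    using linear_add[OF coord_field_linear[OF c]] linear_scale[OF coord_field_linear[OF c]]
    by (simp add: fun_eq_iff)
  then show ?thesis using coord_field_in_tangent_space[OF c] by simp
qed

lemma tangent_space_zero: "p \<in> carrier A \<Longrightarrow> (\<lambda>h. 0) \<in> tangent_space A p"
proof -
  assume p: "p \<in> carrier A"
  then obtain V \<phi> where c: "(V, \<phi>) \<in> A" "p \<in> V" using carrier_chart by blast
  then show ?thesis
    using tangent_lincomb[OF p coord_field_in_tangent_space[OF c] coord_field_in_tangent_space[OF c],
        of 0 undefined 0 undefined] by simp
qed

lemma tangent_const:
  assumes "p \<in> carrier A" "v \<in> tangent_space A p"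
  shows "v (\<lambda>q. r) = 0"
proof -
  obtain V \<phi> where c: "(V, \<phi>) \<in> A" "p \<in> V" using assms(1) carrier_chart by blast
  obtain u where "v = coord_field A (V, \<phi>) u p"
    using assms tangent_space_chart[OF c] by blast
  then show ?thesis by (simp add: coord_field_def o_def frechet_derivative_const)
qed

section \<open>Smooth vector fields\<close>

lemma smooth_vf_open: "smooth_vf A U X \<Longrightarrow> open U"
  and smooth_vf_carrier: "smooth_vf A U X \<Longrightarrow> U \<subseteq> carrier A"
  and smooth_vf_tangent: "smooth_vf A U X \<Longrightarrow> p \<in> U \<Longrightarrow> X p \<in> tangent_space A p"
  and smooth_vf_apply:
    "smooth_vf A U X \<Longrightarrow> V \<subseteq> U \<Longrightarrow> smooth_fun A V h \<Longrightarrow> smooth_fun A V (\<lambda>p. X p h)"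
  unfolding smooth_vf_def by auto

lemma smooth_vf_restrict: "smooth_vf A U X \<Longrightarrow> open U' \<Longrightarrow> U' \<subseteq> U \<Longrightarrow> smooth_vf A U' X"
  unfolding smooth_vf_def by blast

lemma smooth_vf_cong:
  assumes "smooth_vf A U X" "\<And>p. p \<in> U \<Longrightarrow> X p = Y p"
  shows "smooth_vf A U Y"
  unfolding smooth_vf_def
proof (intro conjI allI impI ballI)
  show "Y p \<in> tangent_space A p" if "p \<in> U" for p
    using smooth_vf_tangent[OF assms(1) that] assms(2)[OF that] by simp
  show "smooth_fun A V (\<lambda>p. Y p h)" if "V \<subseteq> U \<and> smooth_fun A V h" for V h
    by (rule smooth_fun_cong[OF smooth_vf_apply[OF assms(1)]]) (use that assms(2) in auto)
qed (use smooth_vf_open[OF assms(1)] smooth_vf_carrier[OF assms(1)] in auto)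

lemma smooth_vf_local:
  assumes "\<And>p. p \<in> U \<Longrightarrow> \<exists>W. p \<in> W \<and> W \<subseteq> U \<and> smooth_vf A W X"
  shows "smooth_vf A U X"
  unfolding smooth_vf_def
proof (intro conjI allI impI ballI)
  show "open U" using assms smooth_vf_open by (subst open_subopen) blast
  show "U \<subseteq> carrier A" using assms smooth_vf_carrier by blast
  show "X p \<in> tangent_space A p" if "p \<in> U" for p
    using assms[OF that] smooth_vf_tangent by blast
  show "smooth_fun A V (\<lambda>p. X p h)" if V: "V \<subseteq> U \<and> smooth_fun A V h" for V h
  proof (rule smooth_fun_local)
    fix p assume p: "p \<in> V"
    then obtain W where W: "p \<in> W" "smooth_vf A W X" using V assms by blast
    have "smooth_fun A (V \<inter> W) h"
      using V smooth_vf_open[OF W(2)] smooth_fun_open by (blast intro: smooth_fun_restrict)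
    then have "smooth_fun A (V \<inter> W) (\<lambda>p. X p h)"
      using smooth_vf_apply[OF W(2)] by blast
    with p W(1) show "\<exists>W. p \<in> W \<and> W \<subseteq> V \<and> smooth_fun A W (\<lambda>p. X p h)"
      by (intro exI[of _ "V \<inter> W"]) simp
  qed
qed

lemma smooth_vf_lincomb:
  assumes "smooth_fun A U a" "smooth_fun A U b" "smooth_vf A U X" "smooth_vf A U Y"
  shows "smooth_vf A U (\<lambda>p w. a p * X p w + b p * Y p w)"
  unfolding smooth_vf_def
proof (intro conjI allI impI ballI)
  show "(\<lambda>w. a p * X p w + b p * Y p w) \<in> tangent_space A p" if "p \<in> U" for p
    using that assms smooth_vf_tangent smooth_vf_carrier by (blast intro: tangent_lincomb)
  show "smooth_fun A V (\<lambda>p. a p * X p h + b p * Y p h)" if V: "V \<subseteq> U \<and> smooth_fun A V h" for V h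
  proof -
    have "smooth_fun A V a" "smooth_fun A V b"
      using V assms(1,2) smooth_fun_open smooth_fun_restrict by blast+
    moreover have "smooth_fun A V (\<lambda>p. X p h)" "smooth_fun A V (\<lambda>p. Y p h)"
      using V assms(3,4) smooth_vf_apply by blast+
    ultimately show ?thesis by (intro smooth_fun_add smooth_fun_mult)
  qed
qed (use smooth_vf_open[OF assms(3)] smooth_vf_carrier[OF assms(3)] in auto)

lemma smooth_vf_scale:
  "smooth_fun A U a \<Longrightarrow> smooth_vf A U X \<Longrightarrow> smooth_vf A U (\<lambda>p w. a p * X p w)"
  using smooth_vf_lincomb[of U a "\<lambda>p. 0" X X]
  by (simp add: smooth_fun_const smooth_fun_open smooth_fun_carrier)

lemma smooth_vf_add:
  "smooth_vf A U X \<Longrightarrow> smooth_vf A U Y \<Longrightarrow> smooth_vf A U (\<lambda>p w. X p w + Y p w)"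
  using smooth_vf_lincomb[of U "\<lambda>p. 1" "\<lambda>p. 1" X Y]
  by (simp add: smooth_fun_const smooth_vf_open smooth_vf_carrier)

lemma smooth_vf_zero:
  assumes "open U" "U \<subseteq> carrier A"
  shows "smooth_vf A U (\<lambda>p w. 0)"
  unfolding smooth_vf_def using assms tangent_space_zero
  by (auto intro!: smooth_fun_const dest: smooth_fun_open)

lemma smooth_vf_sum:
  assumes "open U" "U \<subseteq> carrier A" "\<And>i. i \<in> B \<Longrightarrow> smooth_vf A U (X i)"
  shows "smooth_vf A U (\<lambda>p w. \<Sum>i\<in>B. X i p w)"
  using assms(3)
  by (induction B rule: infinite_finite_induct) (simp_all add: smooth_vf_zero smooth_vf_add assms)

text \<open>By \<open>smooth_funI\<close> it is enough to look in the chart itself, where the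
  function in question is the directional derivative of the representative of \<open>h\<close> along
  the constant vector \<open>u\<close>.\<close>

lemma coord_field_smooth:
  assumes c: "(V, \<phi>) \<in> A"
  shows "smooth_vf A V (coord_field A (V, \<phi>) u)"
  unfolding smooth_vf_def
proof (intro conjI allI impI ballI)
  show "coord_field A (V, \<phi>) u p \<in> tangent_space A p" if "p \<in> V" for p
    by (rule coord_field_in_tangent_space[OF c that])
  show "smooth_fun A W (\<lambda>p. coord_field A (V, \<phi>) u p h)" if W: "W \<subseteq> V \<and> smooth_fun A W h" for W h
  proof (rule smooth_funI)
    show W': "open W" using W smooth_fun_open by blast
    have o: "open (\<phi> ` W)" using open_chart_image[OF c W'] W by blast
    have WV: "W \<inter> V = W" using W by blast
    have "smooth_on (\<phi> ` W) (\<lambda>x. frechet_derivative (h \<circ> inv_into V \<phi>) (at x) u)"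
      using smooth_on_directional[OF smooth_fun_chart[OF conjunct2[OF W] c]] WV by simp
    then have "smooth_on (\<phi> ` W) ((\<lambda>p. coord_field A (V, \<phi>) u p h) \<circ> inv_into V \<phi>)"
    proof (rule smooth_on_cong[OF o])
      fix x assume "x \<in> \<phi> ` W"
      then obtain q where q: "q \<in> W" "q \<in> V" "x = \<phi> q" using W by blast
      then show "frechet_derivative (h \<circ> inv_into V \<phi>) (at x) u =
          ((\<lambda>p. coord_field A (V, \<phi>) u p h) \<circ> inv_into V \<phi>) x"
        using smooth_fun_near[OF conjunct2[OF W]] chart_inv[OF c] by (simp add: coord_field_def)
    qed
    then show "\<exists>V' \<phi>' W'. (V', \<phi>') \<in> A \<and> open W' \<and> p \<in> W' \<and> W' \<subseteq> V' \<and>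
        smooth_on (\<phi>' ` W') ((\<lambda>p. coord_field A (V, \<phi>) u p h) \<circ> inv_into V' \<phi>')"
      if "p \<in> W" for p
      using c W W' that by blast
  qed
qed (use open_chart[OF c] chart_subset_carrier[OF c] in auto)

lemma tangent_sum:
  assumes "p \<in> carrier A" "\<And>i. i \<in> B \<Longrightarrow> v i \<in> tangent_space A p"
  shows "(\<lambda>h. \<Sum>i\<in>B. c i * v i h) \<in> tangent_space A p"
  using assms(2)
proof (induction B rule: infinite_finite_induct)
  case (insert i B)
  then show ?case
    using tangent_lincomb[OF assms(1), of "v i" "\<lambda>h. \<Sum>i\<in>B. c i * v i h" "c i" 1] by simp
qed (simp_all add: tangent_space_zero[OF assms(1)])

end

section \<open>Gradients\<close>

locale riemannian_manifold = manifold A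
  for A :: "('m::{t2_space,second_countable_topology}, 'e::euclidean_space) chart set" +
  fixes g :: "'m metric"
  assumes riemannian_metric: "riemannian_metric A g"
begin

section \<open>Linear algebra of the metric on a tangent space\<close>

lemma metric_lincomb_left:
  "p \<in> carrier A \<Longrightarrow> u \<in> tangent_space A p \<Longrightarrow> v \<in> tangent_space A p \<Longrightarrow> w \<in> tangent_space A p \<Longrightarrow>
    g p (\<lambda>h. r * u h + s * v h) w = r * g p u w + s * g p v w"
  using riemannian_metric unfolding riemannian_metric_def by simp

lemma metric_sym:
  "p \<in> carrier A \<Longrightarrow> u \<in> tangent_space A p \<Longrightarrow> v \<in> tangent_space A p \<Longrightarrow> g p u v = g p v u"
  using riemannian_metric unfolding riemannian_metric_def by simp

lemma metric_pos:
  "p \<in> carrier A \<Longrightarrow> v \<in> tangent_space A p \<Longrightarrow> v \<noteq> (\<lambda>h. 0) \<Longrightarrow> g p v v > 0"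
  using riemannian_metric unfolding riemannian_metric_def by simp

lemma metric_smooth:
  "smooth_vf A U X \<Longrightarrow> smooth_vf A U Y \<Longrightarrow> smooth_fun A U (\<lambda>p. g p (X p) (Y p))"
  using riemannian_metric unfolding riemannian_metric_def by simp

lemma metric_lincomb_right:
  assumes "p \<in> carrier A" "u \<in> tangent_space A p" "v \<in> tangent_space A p" "w \<in> tangent_space A p"
  shows "g p w (\<lambda>h. r * u h + s * v h) = r * g p w u + s * g p w v"
  using metric_lincomb_left[OF assms] metric_sym[OF assms(1,4)] tangent_lincomb[OF assms(1-3)] assms
  by simp

lemma metric_zero_left:
  assumes "p \<in> carrier A" "w \<in> tangent_space A p"
  shows "g p (\<lambda>h. 0) w = 0"
  using metric_lincomb_left[OF assms(1) tangent_space_zero tangent_space_zero, of w 0 0] assms by simp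

lemma metric_sum_right:
  assumes "p \<in> carrier A" "w \<in> tangent_space A p" "\<And>i. i \<in> B \<Longrightarrow> v i \<in> tangent_space A p"
  shows "g p w (\<lambda>h. \<Sum>i\<in>B. c i * v i h) = (\<Sum>i\<in>B. c i * g p w (v i))"
proof -
  have zero: "g p w (\<lambda>h. 0) = 0"
    using metric_zero_left metric_sym tangent_space_zero assms(1,2) by metis
  show ?thesis
    using assms(3)
  proof (induction B rule: infinite_finite_induct)
    case (insert i B)
    then have "(\<lambda>h. \<Sum>i\<in>B. c i * v i h) \<in> tangent_space A p"
      by (intro tangent_sum assms(1)) simp
    with insert show ?case
      using metric_lincomb_right[OF assms(1) _ _ assms(2),
          of "v i" "\<lambda>h. \<Sum>i\<in>B. c i * v i h" "c i" 1] by simp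
  qed (simp_all add: zero)
qed

text \<open>Products with the coordinate fields determine all products with \<open>w\<close>. This
  serves both the positivity argument for the dual field and the defining property of the
  gradient.\<close>

lemma metric_chart:
  assumes "(V, \<phi>) \<in> A" "p \<in> V" "w \<in> tangent_space A p" "v \<in> tangent_space A p"
  shows "g p w v = (\<Sum>b\<in>Basis. v (coord_fun (V, \<phi>) b) * g p w (coord_field A (V, \<phi>) b p))"
proof -
  have p: "p \<in> carrier A" using assms chart_subset_carrier by blast
  have "v = (\<lambda>h. \<Sum>b\<in>Basis. v (coord_fun (V, \<phi>) b) * coord_field A (V, \<phi>) b p h)"
    using tangent_expansion[OF assms(1,2,4)] by blast
  then have "g p w v =
      g p w (\<lambda>h. \<Sum>b\<in>Basis. v (coord_fun (V, \<phi>) b) * coord_field A (V, \<phi>) b p h)"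
    by metis
  also have "\<dots> = (\<Sum>b\<in>Basis. v (coord_fun (V, \<phi>) b) * g p w (coord_field A (V, \<phi>) b p))"
    by (rule metric_sum_right[OF p assms(3) coord_field_in_tangent_space[OF assms(1,2)]])
  finally show ?thesis .
qed

lemma metric_nondegenerate:
  assumes p: "p \<in> carrier A" and w: "w \<in> tangent_space A p" "w' \<in> tangent_space A p"
    and eq: "\<And>v. v \<in> tangent_space A p \<Longrightarrow> g p w v = g p w' v"
  shows "w = w'"
proof -
  \<comment> \<open>The difference of the two vectors, written in the shape of the linearity rule;
    it is tested against itself.\<close>
  let ?d = "\<lambda>h. 1 * w h + (- 1) * w' h"
  have d: "?d \<in> tangent_space A p" by (rule tangent_lincomb[OF p w])
  have "g p ?d ?d = 0"
    using metric_lincomb_left[OF p w d, of 1 "- 1"] eq[OF d] by simp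
  then have "?d = (\<lambda>h. 0)" using metric_pos[OF p d] by force
  then show ?thesis by (simp add: fun_eq_iff)
qed

text \<open>Solving for prescribed products with the coordinate fields one basis vector at a time:
  \<open>N\<close> below is the projection of the new coordinate field to the span of the previous ones,
  so that \<open>E\<close> is orthogonal to that span. This avoids inverting the Gram matrix.\<close>

lemma dual_field_exists:
  assumes c: "(V, \<phi>) \<in> A" and "finite B" "B \<subseteq> Basis"
    and "\<And>b. b \<in> B \<Longrightarrow> smooth_fun A V (F b)"
  shows "\<exists>W. smooth_vf A V W \<and>
    (\<forall>p\<in>V. \<forall>a\<in>Basis - B. W p (coord_fun (V, \<phi>) a) = 0) \<and>
    (\<forall>p\<in>V. \<forall>b\<in>B. g p (W p) (coord_field A (V, \<phi>) b p) = F b p)"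
  using assms(2-4)
proof (induction B arbitrary: F)
  case empty
  show ?case
    using smooth_vf_zero[OF open_chart[OF c] chart_subset_carrier[OF c]] by auto
next
  case (insert e B)
  let ?x = "coord_fun (V, \<phi>)" and ?d = "coord_field A (V, \<phi>)"
  note d = coord_field_smooth[OF c]
  have dT: "?d b p \<in> tangent_space A p" if "p \<in> V" for b p
    by (rule coord_field_in_tangent_space[OF c that])
  have carr: "p \<in> carrier A" if "p \<in> V" for p
    using that chart_subset_carrier[OF c] by blast
  \<comment> \<open>The vanishing components outside \<open>B\<close> say that \<open>N\<close> lies
    in the span of the fields indexed by \<open>B\<close>. The induction carries this condition
    along because it fixes the components of \<open>E\<close> below.\<close>
  obtain N where N: "smooth_vf A V N" "\<And>p a. p \<in> V \<Longrightarrow> a \<in> Basis - B \<Longrightarrow> N p (?x a) = 0"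
      "\<And>p b. p \<in> V \<Longrightarrow> b \<in> B \<Longrightarrow> g p (N p) (?d b p) = g p (?d e p) (?d b p)"
    using insert.IH[of "\<lambda>b p. g p (?d e p) (?d b p)"] insert.prems(1) metric_smooth[OF d d] by auto
  obtain W where W: "smooth_vf A V W" "\<And>p a. p \<in> V \<Longrightarrow> a \<in> Basis - B \<Longrightarrow> W p (?x a) = 0"
      "\<And>p b. p \<in> V \<Longrightarrow> b \<in> B \<Longrightarrow> g p (W p) (?d b p) = F b p"
    using insert.IH[of F] insert.prems by auto
  note NT = smooth_vf_tangent[OF N(1)] and WT = smooth_vf_tangent[OF W(1)]
  have one: "smooth_fun A V (\<lambda>p. r)" for r
    by (rule smooth_fun_const[OF open_chart[OF c] chart_subset_carrier[OF c]])
  define E where "E = (\<lambda>p w. 1 * ?d e p w + (- 1) * N p w)"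
  have E: "smooth_vf A V E"
    unfolding E_def by (rule smooth_vf_lincomb[OF one one d N(1)])
  note ET = smooth_vf_tangent[OF E]
  have gE: "g p (E p) v = g p (?d e p) v - g p (N p) v" if "p \<in> V" "v \<in> tangent_space A p" for p v
    unfolding E_def
    using metric_lincomb_left[OF carr[OF that(1)] dT[OF that(1), of e] NT[OF that(1)] that(2), of 1 "- 1"]
    by simp
  have E_perp: "g p (E p) (?d b p) = 0" if "p \<in> V" "b \<in> B" for p b
    using that gE[OF that(1) dT] N(3) by simp
  have Ex: "E p (?x a) = (if a = e then 1 else 0)" if "p \<in> V" "a \<in> Basis - B" for p a
    using that N(2)[OF that] coord_field_coord_fun[OF c that(1), of e a] insert.prems(1)
    by (auto simp: E_def inner_Basis)
  \<comment> \<open>\<open>E\<close> has component 1 at \<open>e\<close>, hence is nonzero. In the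
    expansion of \<open>g p (E p) (E p)\<close> the terms from \<open>B\<close> vanish by
    orthogonality and the others off \<open>e\<close> because \<open>E\<close> has no such
    component, so what remains equals the divisor used in \<open>s\<close>.\<close>
  have E_pos: "g p (E p) (?d e p) > 0" if p: "p \<in> V" for p
  proof -
    have "E p (?x e) = 1" using Ex[OF p, of e] insert.hyps(2) insert.prems(1) by simp
    then have "E p \<noteq> (\<lambda>h. 0)" by auto
    then have "0 < g p (E p) (E p)" by (rule metric_pos[OF carr[OF p] ET[OF p]])
    also have "\<dots> = (\<Sum>b\<in>Basis. E p (?x b) * g p (E p) (?d b p))"
      by (rule metric_chart[OF c p ET[OF p] ET[OF p]])
    also have "\<dots> = (\<Sum>b\<in>Basis. if b = e then g p (E p) (?d e p) else 0)"
    proof (rule sum.cong[OF refl])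
      show "E p (?x b) * g p (E p) (?d b p) = (if b = e then g p (E p) (?d e p) else 0)"
        if "b \<in> Basis" for b
        using that Ex[OF p, of b] E_perp[OF p, of b] insert.hyps(2) by (cases "b \<in> B") auto
    qed
    also have "\<dots> = g p (E p) (?d e p)" using insert.prems(1) by simp
    finally show ?thesis .
  qed
  \<comment> \<open>The solution of \<open>g p (W p + s p * E p) (?d e p) = F e p\<close>. Adding a
    multiple of \<open>E\<close> leaves the products with the fields of \<open>B\<close>
    unchanged.\<close>
  define s where "s = (\<lambda>p. (F e p + (- 1) * g p (W p) (?d e p)) * inverse (g p (E p) (?d e p)))"
  have s: "smooth_fun A V s"
    unfolding s_def
    by (intro smooth_fun_mult smooth_fun_add smooth_fun_inverse one metric_smooth W(1) E d)
       (use insert.prems(2) in blast, use E_pos in \<open>simp add: less_imp_neq[symmetric]\<close>)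
  let ?W = "\<lambda>p w. 1 * W p w + s p * E p w"
  have gW: "g p (?W p) v = g p (W p) v + s p * g p (E p) v"
    if "p \<in> V" "v \<in> tangent_space A p" for p v
    using metric_lincomb_left[OF carr[OF that(1)] WT[OF that(1)] ET[OF that(1)] that(2), of 1 "s p"]
    by simp
  show ?case
  proof (intro exI[of _ ?W] conjI ballI)
    show "smooth_vf A V ?W" by (rule smooth_vf_lincomb[OF one s W(1) E])
    show "?W p (?x a) = 0" if "p \<in> V" "a \<in> Basis - insert e B" for p a
      using that W(2) Ex by auto
    show "g p (?W p) (?d b p) = F b p" if p: "p \<in> V" and b: "b \<in> insert e B" for p b
    proof (cases "b \<in> B")
      case True
      then show ?thesis using gW[OF p dT[OF p]] W(3)[OF p] E_perp[OF p] by simp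
    next
      case False
      with b have "b = e" by simp
      have "s p * g p (E p) (?d e p) = F e p - g p (W p) (?d e p)"
        using E_pos[OF p] by (simp add: s_def)
      then show ?thesis using gW[OF p dT[OF p, of e]] \<open>b = e\<close> by simp
    qed
  qed
qed

section \<open>Existence, smoothness and nonvanishing of the gradient\<close>

lemma gradient_eqI:
  assumes "p \<in> carrier A" "w \<in> tangent_space A p" "\<And>v. v \<in> tangent_space A p \<Longrightarrow> g p w v = v f"
  shows "gradient A g f p = w"
  unfolding gradient_def
proof (rule the_equality)
  show "w' = w" if "w' \<in> tangent_space A p \<and> (\<forall>v\<in>tangent_space A p. g p w' v = v f)" for w'
    using that assms(3) by (intro metric_nondegenerate[OF assms(1) _ assms(2)]) auto
qed (use assms in blast)

text \<open>The dual field for the values \<open>?d b p f\<close> depends on the chart in its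
  construction, but by linearity it represents the differential on all tangent vectors. Uniqueness
  then identifies it with the global gradient.\<close>

lemma gradient_local:
  assumes f: "smooth_fun A (carrier A) f" and c: "(V, \<phi>) \<in> A"
  shows "smooth_vf A V (gradient A g f)"
    and "p \<in> V \<Longrightarrow> v \<in> tangent_space A p \<Longrightarrow> g p (gradient A g f p) v = v f"
proof -
  let ?d = "coord_field A (V, \<phi>)"
  have "smooth_fun A V f"
    by (rule smooth_fun_restrict[OF f open_chart[OF c] chart_subset_carrier[OF c]])
  then have "smooth_fun A V (\<lambda>p. ?d b p f)" for b
    by (rule smooth_vf_apply[OF coord_field_smooth[OF c] order.refl])
  then obtain W where W: "smooth_vf A V W"
      "\<And>p b. p \<in> V \<Longrightarrow> b \<in> Basis \<Longrightarrow> g p (W p) (?d b p) = ?d b p f"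
    using dual_field_exists[OF c finite_Basis order.refl, of "\<lambda>b p. ?d b p f"] by auto
  have gW: "g p (W p) v = v f" if "p \<in> V" "v \<in> tangent_space A p" for p v
  proof -
    have "g p (W p) v = (\<Sum>b\<in>Basis. v (coord_fun (V, \<phi>) b) * ?d b p f)"
      unfolding metric_chart[OF c that(1) smooth_vf_tangent[OF W(1) that(1)] that(2)]
      by (rule sum.cong) (simp_all add: W(2)[OF that(1)])
    also have "\<dots> = v f" by (rule tangent_expansion[OF c that, symmetric])
    finally show ?thesis .
  qed
  have G: "gradient A g f p = W p" if "p \<in> V" for p
    using that gW smooth_vf_tangent[OF W(1)] chart_subset_carrier[OF c]
    by (intro gradient_eqI) auto
  show "smooth_vf A V (gradient A g f)"
    by (rule smooth_vf_cong[OF W(1)]) (simp add: G)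
  show "p \<in> V \<Longrightarrow> v \<in> tangent_space A p \<Longrightarrow> g p (gradient A g f p) v = v f"
    using G gW by simp
qed

lemma gradient_smooth:
  assumes "smooth_fun A (carrier A) f"
  shows "smooth_vf A (carrier A) (gradient A g f)"
proof (rule smooth_vf_local)
  fix p assume "p \<in> carrier A"
  then obtain V \<phi> where c: "(V, \<phi>) \<in> A" "p \<in> V" using carrier_chart by blast
  then show "\<exists>W. p \<in> W \<and> W \<subseteq> carrier A \<and> smooth_vf A W (gradient A g f)"
    using chart_subset_carrier[OF c(1)] gradient_local(1)[OF assms c(1)] by blast
qed

lemma metric_gradient:
  assumes "smooth_fun A (carrier A) f" "p \<in> carrier A" "v \<in> tangent_space A p"
  shows "g p (gradient A g f p) v = v f"
  using assms carrier_chart gradient_local(2) by metis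

lemma gradient_regular_pos:
  assumes f: "smooth_fun A (carrier A) f" and p: "p \<in> regular_part A f"
  shows "g p (gradient A g f p) (gradient A g f p) > 0"
proof -
  have c: "p \<in> carrier A" using p by (simp add: regular_part_def)
  have "gradient A g f p \<noteq> (\<lambda>h. 0)"
  proof
    assume "gradient A g f p = (\<lambda>h. 0)"
    then have "critical_point A f p"
      using metric_gradient[OF f c] metric_zero_left[OF c] c by (simp add: critical_point_def)
    then show False using p by (simp add: regular_part_def)
  qed
  then show ?thesis
    by (rule metric_pos[OF c smooth_vf_tangent[OF gradient_smooth[OF f] c]])
qed

end

section \<open>Connections\<close>

context manifold
begin

context
  fixes W :: "'m set" and nabla :: "'m vfield \<Rightarrow> 'm vfield \<Rightarrow> 'm vfield"
  assumes conn: "affine_connection A W nabla"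
begin

section \<open>Algebra of an affine connection\<close>

lemma connection_open: "open W" and connection_carrier: "W \<subseteq> carrier A"
  using conn unfolding affine_connection_def by auto

lemma connection_smooth:
  assumes "U \<subseteq> W" "smooth_vf A U X" "smooth_vf A U Y"
  shows "smooth_vf A U (nabla X Y)"
  using conn[unfolded affine_connection_def, THEN conjunct2, THEN conjunct2, THEN conjunct1,
      rule_format, of U X Y] assms by blast

lemma connection_cong:
  assumes "U \<subseteq> W" "smooth_vf A U X" "smooth_vf A U X'" "smooth_vf A U Y" "smooth_vf A U Y'"
    and "\<And>q. q \<in> U \<Longrightarrow> X q = X' q" "\<And>q. q \<in> U \<Longrightarrow> Y q = Y' q" "p \<in> U"
  shows "nabla X Y p = nabla X' Y' p"
  using conn[unfolded affine_connection_def, THEN conjunct2, THEN conjunct2, THEN conjunct2,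
      THEN conjunct1, rule_format, of U X X' Y Y' p] assms by blast

lemma connection_lincomb_left:
  assumes "U \<subseteq> W" "smooth_vf A U X" "smooth_vf A U X'" "smooth_vf A U Y"
    and "smooth_fun A U h" "smooth_fun A U k" "p \<in> U"
  shows "nabla (\<lambda>q w. h q * X q w + k q * X' q w) Y p =
    (\<lambda>w. h p * nabla X Y p w + k p * nabla X' Y p w)"
  by (rule conn[unfolded affine_connection_def, THEN conjunct2, THEN conjunct2, THEN conjunct2,
      THEN conjunct2, THEN conjunct1, rule_format, of U]) (use assms in auto)

lemma connection_add_right:
  assumes "U \<subseteq> W" "smooth_vf A U X" "smooth_vf A U Y" "smooth_vf A U Y'" "p \<in> U"
  shows "nabla X (\<lambda>q w. Y q w + Y' q w) p = (\<lambda>w. nabla X Y p w + nabla X Y' p w)"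
  by (rule conn[unfolded affine_connection_def, THEN conjunct2, THEN conjunct2, THEN conjunct2,
      THEN conjunct2, THEN conjunct2, THEN conjunct1, rule_format, of U]) (use assms in auto)

lemma connection_Leibniz:
  assumes "U \<subseteq> W" "smooth_vf A U X" "smooth_vf A U Y" "smooth_fun A U h" "p \<in> U"
  shows "nabla X (\<lambda>q w. h q * Y q w) p = (\<lambda>w. X p h * Y p w + h p * nabla X Y p w)"
  by (rule conn[unfolded affine_connection_def, THEN conjunct2, THEN conjunct2, THEN conjunct2,
      THEN conjunct2, THEN conjunct2, THEN conjunct2, rule_format, of U]) (use assms in auto)

lemma connection_sum_left:
  assumes U: "U \<subseteq> W" "smooth_vf A U Y" "p \<in> U"
    and X: "\<And>i. i \<in> B \<Longrightarrow> smooth_vf A U (X i)" "\<And>i. i \<in> B \<Longrightarrow> smooth_fun A U (h i)"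
  shows "nabla (\<lambda>q w. \<Sum>i\<in>B. h i q * X i q w) Y p = (\<lambda>w. \<Sum>i\<in>B. h i p * nabla (X i) Y p w)"
proof -
  note o = smooth_vf_open[OF U(2)] smooth_vf_carrier[OF U(2)]
  \<comment> \<open>The zero field is a combination with coefficients 0; this settles both the empty
    sum and the infinite one, which is 0 by convention.\<close>
  have zero: "nabla (\<lambda>q w. 0) Y p = (\<lambda>w. 0)"
    using connection_lincomb_left[OF U(1) smooth_vf_zero smooth_vf_zero U(2)
        smooth_fun_const smooth_fun_const U(3), of 0 0] o by simp
  show ?thesis
    using X
  proof (induction B rule: infinite_finite_induct)
    case (insert i B)
    have "smooth_vf A U (\<lambda>q w. \<Sum>i\<in>B. h i q * X i q w)"
      using insert.prems by (intro smooth_vf_sum o smooth_vf_scale) simp_all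
    from connection_lincomb_left[OF U(1) _ this U(2) _ smooth_fun_const[OF o] U(3), of "X i" "h i" 1]
    show ?case using insert by simp
  qed (simp_all add: zero)
qed

lemma connection_sum_right:
  assumes U: "U \<subseteq> W" "smooth_vf A U X" "p \<in> U"
    and Y: "\<And>i. i \<in> B \<Longrightarrow> smooth_vf A U (Y i)"
  shows "nabla X (\<lambda>q w. \<Sum>i\<in>B. Y i q w) p = (\<lambda>w. \<Sum>i\<in>B. nabla X (Y i) p w)"
proof -
  note o = smooth_vf_open[OF U(2)] smooth_vf_carrier[OF U(2)]
  have zero: "nabla X (\<lambda>q w. 0) p = (\<lambda>w. 0)"
    using connection_Leibniz[OF U(1,2) smooth_vf_zero[OF o] smooth_fun_const[OF o] U(3), of 0]
    by simp
  show ?thesis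
    using Y
  proof (induction B rule: infinite_finite_induct)
    case (insert i B)
    have "smooth_vf A U (\<lambda>q w. \<Sum>i\<in>B. Y i q w)"
      using insert.prems by (intro smooth_vf_sum o) simp_all
    from connection_add_right[OF U(1,2) _ this U(3), of "Y i"]
    show ?case using insert by simp
  qed (simp_all add: zero)
qed

text \<open>One sign leaves the first slot by linearity; the other leaves the second by the Leibniz
  rule, since tangent vectors annihilate the constant \<open>- 1\<close>.\<close>

lemma connection_negate:
  assumes U: "U \<subseteq> W" "smooth_vf A U X" "smooth_vf A U Y" "p \<in> U"
  shows "nabla (\<lambda>q w. - X q w) (\<lambda>q w. - Y q w) p = nabla X Y p"
proof -
  note o = smooth_vf_open[OF U(2)] smooth_vf_carrier[OF U(2)]
  have p: "p \<in> carrier A" using U(4) o(2) by blast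
  have c: "smooth_fun A U (\<lambda>p. r)" for r by (rule smooth_fun_const[OF o])
  have mY: "smooth_vf A U (\<lambda>q w. - 1 * Y q w)" by (rule smooth_vf_scale[OF c U(3)])
  have "nabla (\<lambda>q w. - X q w) (\<lambda>q w. - Y q w) p = (\<lambda>w. - nabla X (\<lambda>q w. - Y q w) p w)"
    using connection_lincomb_left[OF U(1,2,2) mY c c U(4), of "- 1" 0] by simp
  also have "nabla X (\<lambda>q w. - Y q w) p = (\<lambda>w. - nabla X Y p w)"
    using connection_Leibniz[OF U(1,2,3) c U(4), of "- 1"]
      tangent_const[OF p smooth_vf_tangent[OF U(2,4)]] by simp
  finally show ?thesis by simp
qed

lemma connection_restrict:
  assumes "open W'" "W' \<subseteq> W"
  shows "affine_connection A W' nabla"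
  unfolding affine_connection_def
proof (intro conjI allI impI ballI; (elim conjE)?)
  show "open W'" by fact
  show "W' \<subseteq> carrier A" using assms(2) connection_carrier by blast
next
  fix U X Y assume "U \<subseteq> W'" "smooth_vf A U X" "smooth_vf A U Y"
  then show "smooth_vf A U (nabla X Y)" using assms(2) by (intro connection_smooth) auto
next
  fix U X X' Y Y' p
  assume "U \<subseteq> W'" "smooth_vf A U X" "smooth_vf A U X'" "smooth_vf A U Y" "smooth_vf A U Y'"
    "\<forall>p\<in>U. X p = X' p \<and> Y p = Y' p" "p \<in> U"
  then show "nabla X Y p = nabla X' Y' p" using assms(2) by (intro connection_cong) auto
next
  fix U X X' Y h k p
  assume "U \<subseteq> W'" "smooth_vf A U X" "smooth_vf A U X'" "smooth_vf A U Y"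
    "smooth_fun A U h" "smooth_fun A U k" "p \<in> U"
  with assms(2) show "nabla (\<lambda>q w. h q * X q w + k q * X' q w) Y p =
      (\<lambda>w. h p * nabla X Y p w + k p * nabla X' Y p w)"
    by (intro connection_lincomb_left) auto
next
  fix U X Y Y' p
  assume "U \<subseteq> W'" "smooth_vf A U X" "smooth_vf A U Y" "smooth_vf A U Y'" "p \<in> U"
  with assms(2) show "nabla X (\<lambda>q w. Y q w + Y' q w) p = (\<lambda>w. nabla X Y p w + nabla X Y' p w)"
    by (intro connection_add_right) auto
next
  fix U X Y h p
  assume "U \<subseteq> W'" "smooth_vf A U X" "smooth_vf A U Y" "smooth_fun A U h" "p \<in> U"
  with assms(2) show "nabla X (\<lambda>q w. h q * Y q w) p = (\<lambda>w. X p h * Y p w + h p * nabla X Y p w)"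
    by (intro connection_Leibniz) auto
qed

text \<open>For an integral curve, the derivative along the curve of a coefficient of the velocity is the
  field applied to that coefficient, so that the coordinate formula is the expansion of
  \<open>nabla X X\<close> in the coordinate fields.\<close>

lemma cov_deriv_integral_curve:
  assumes X: "smooth_vf A W X" and \<gamma>: "integral_curve A X I \<gamma>" "\<gamma> ` I \<subseteq> W" and t: "t \<in> I"
    and c: "(V, \<phi>) \<in> A" "\<gamma> t \<in> V"
  shows "cov_deriv_along A nabla (V, \<phi>) \<gamma> (velocity A \<gamma>) t = nabla X X (\<gamma> t)"
proof
  fix w
  \<comment> \<open>Here both \<open>X\<close> and the coordinate fields are smooth and the
    connection applies.\<close>
  define U where "U = W \<inter> V"
  let ?p = "\<gamma> t" and ?x = "coord_fun (V, \<phi>)" and ?d = "coord_field A (V, \<phi>)"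
  let ?X = "\<lambda>b q. X q (?x b)"
  let ?E = "\<lambda>q w. \<Sum>b\<in>Basis. ?X b q * ?d b q w"
  have curve: "smooth_curve A I \<gamma>" and vel: "\<And>s. s \<in> I \<Longrightarrow> velocity A \<gamma> s = X (\<gamma> s)"
    using \<gamma>(1) by (auto simp: integral_curve_def)
  have I: "open I" using curve by (simp add: smooth_curve_def)
  have U: "open U" "U \<subseteq> W" "U \<subseteq> V" "?p \<in> U" "U \<subseteq> carrier A"
    using smooth_vf_open[OF X] open_chart[OF c(1)] c(2) \<gamma>(2) t connection_carrier
    by (auto simp: U_def)
  have XU: "smooth_vf A U X" by (rule smooth_vf_restrict[OF X U(1,2)])
  have d: "smooth_vf A U (?d b)" for b
    by (rule smooth_vf_restrict[OF coord_field_smooth[OF c(1)] U(1,3)])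
  have x: "smooth_fun A U (?x b)" for b
    by (rule smooth_fun_restrict[OF coord_fun_smooth[OF c(1)] U(1,3)])
  have Xb: "smooth_fun A U (?X b)" for b
    by (rule smooth_vf_apply[OF XU order.refl x])
  have E: "smooth_vf A U ?E"
    by (intro smooth_vf_sum U smooth_vf_scale Xb d)
  have XE: "X q = ?E q" if "q \<in> U" for q
    using tangent_expansion[OF c(1) _ smooth_vf_tangent[OF XU that]] U(3) that by blast
  \<comment> \<open>\<open>X\<close> equals its expansion only inside the chart, so the replacement
    goes through locality of the connection on \<open>U\<close>.\<close>
  have "nabla X X ?p w = nabla X ?E ?p w"
    using connection_cong[OF U(2) XU XU XU E refl XE U(4)] by simp
  also have "\<dots> = (\<Sum>b\<in>Basis. nabla X (\<lambda>q w. ?X b q * ?d b q w) ?p w)"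
    using connection_sum_right[where Y = "\<lambda>b q w. ?X b q * ?d b q w" and B = Basis,
        OF U(2) XU U(4) smooth_vf_scale[OF Xb d]] by simp
  also have "\<dots> = (\<Sum>b\<in>Basis. X ?p (?X b) * ?d b ?p w + ?X b ?p * nabla X (?d b) ?p w)"
    using connection_Leibniz[OF U(2) XU d Xb U(4)] by simp
  \<comment> \<open>The first slot is expanded only after the Leibniz rule, so that the derivative
    terms remain \<open>X\<close> applied to its own coefficients.\<close>
  also have "\<dots> = (\<Sum>b\<in>Basis. X ?p (?X b) * ?d b ?p w + ?X b ?p * nabla ?E (?d b) ?p w)"
    using connection_cong[OF U(2) XU E d d XE refl U(4)] by simp
  also have "\<dots> = (\<Sum>b\<in>Basis. X ?p (?X b) * ?d b ?p w +
      ?X b ?p * (\<Sum>a\<in>Basis. ?X a ?p * nabla (?d a) (?d b) ?p w))"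
    using connection_sum_left[where X = ?d and h = ?X and B = Basis, OF U(2) d U(4) d Xb] by simp
  also have "\<dots> = (\<Sum>b\<in>Basis. X ?p (?X b) * ?d b ?p w) +
      (\<Sum>a\<in>Basis. \<Sum>b\<in>Basis. ?X a ?p * ?X b ?p * nabla (?d a) (?d b) ?p w)"
    unfolding sum.distrib sum_distrib_left
    by (subst (2) sum.swap) (simp add: mult.assoc mult.left_commute)
  also have "\<dots> = cov_deriv_along A nabla (V, \<phi>) \<gamma> (velocity A \<gamma>) t w"
  proof -
    \<comment> \<open>Near \<open>t\<close>, inside the open set \<open>I\<close>, the coefficient
      of the velocity is \<open>?X b\<close> evaluated along the curve. Its derivative is the
      velocity applied to the smooth function \<open>?X b\<close>, and the velocity is
      \<open>X\<close> again.\<close>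
    have "deriv (\<lambda>s. velocity A \<gamma> s (?x b)) t = X ?p (?X b)" for b
    proof -
      have "deriv (\<lambda>s. velocity A \<gamma> s (?x b)) t = deriv (\<lambda>s. ?X b (\<gamma> s)) t"
        by (rule deriv_cong_ev[OF _ refl])
           (use eventually_nhds_in_open[OF I t] vel in \<open>auto elim: eventually_mono\<close>)
      also have "\<dots> = velocity A \<gamma> t (?X b)"
        using smooth_fun_near[OF Xb U(4)] by (simp add: velocity_def)
      finally show ?thesis by (simp add: vel[OF t])
    qed
    then show ?thesis by (simp add: cov_deriv_along_def vel[OF t])
  qed
  finally show "cov_deriv_along A nabla (V, \<phi>) \<gamma> (velocity A \<gamma>) t w = nabla X X ?p w" ..
qed

text \<open>The expression \<open>nabla X X\<close> does not mention a chart, so \<open>l\<close>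
  along the curve is one smooth factor valid in all charts.\<close>

lemma integral_curve_pregeodesic:
  assumes X: "smooth_vf A W X" and \<gamma>: "integral_curve A X I \<gamma>" "\<gamma> ` I \<subseteq> W"
    and l: "smooth_fun A W l" and XX: "\<And>p. p \<in> W \<Longrightarrow> nabla X X p = (\<lambda>w. l p * X p w)"
  shows "pregeodesic A W nabla I \<gamma>"
  unfolding pregeodesic_def
proof (intro conjI exI[of _ "\<lambda>t. l (\<gamma> t)"] ballI impI)
  show curve: "smooth_curve A I \<gamma>" using \<gamma>(1) by (simp add: integral_curve_def)
  show "\<gamma> ` I \<subseteq> W" by fact
  show "smooth_on I (\<lambda>t. l (\<gamma> t))" by (rule smooth_fun_compose_curve[OF curve l \<gamma>(2)])
  fix t c assume t: "t \<in> I" and "c \<in> A" "\<gamma> t \<in> fst c"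
  then obtain V \<phi> where c: "c = (V, \<phi>)" "(V, \<phi>) \<in> A" "\<gamma> t \<in> V" by (cases c) auto
  have "\<gamma> t \<in> W" using \<gamma>(2) t by blast
  then show "cov_deriv_along A nabla c \<gamma> (velocity A \<gamma>) t = (\<lambda>w. l (\<gamma> t) * velocity A \<gamma> t w)"
    using cov_deriv_integral_curve[OF X \<gamma> t c(2,3)] XX \<gamma>(1) t
    by (simp add: c(1) integral_curve_def)
qed

end

end

section \<open>Subtracting a symmetric tensor from a connection\<close>

context riemannian_manifold
begin

text \<open>The subtracted term is linear over functions in both slots, so it leaves the derivative
  term \<open>X p h * Y p w\<close> of the Leibniz rule untouched.\<close>

lemma connection_minus_tensor:
  assumes conn: "affine_connection A W nabla" and T: "smooth_vf A W T"
  shows "affine_connection A W (\<lambda>X Y p w. nabla X Y p w - g p (X p) (Y p) * T p w)"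
  unfolding affine_connection_def
proof (intro conjI allI impI ballI; (elim conjE)?)
  show "open W" "W \<subseteq> carrier A"
    using connection_open[OF conn] connection_carrier[OF conn] .
  note carr = subsetD[OF smooth_vf_carrier] and tan = smooth_vf_tangent
  {
    fix U X Y assume U: "U \<subseteq> W" and X: "smooth_vf A U X" and Y: "smooth_vf A U Y"
    have "smooth_vf A U (\<lambda>p w. 1 * nabla X Y p w + (- 1 * g p (X p) (Y p)) * T p w)"
      using smooth_vf_open[OF X] smooth_vf_carrier[OF X] T U X Y
      by (intro smooth_vf_lincomb smooth_fun_mult smooth_fun_const metric_smooth
          connection_smooth[OF conn]) (auto intro: smooth_vf_restrict)
    then show "smooth_vf A U (\<lambda>p w. nabla X Y p w - g p (X p) (Y p) * T p w)" by simp
  next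
    fix U X X' Y Y' p
    assume "U \<subseteq> W" "smooth_vf A U X" "smooth_vf A U X'" "smooth_vf A U Y" "smooth_vf A U Y'"
      and eq: "\<forall>p\<in>U. X p = X' p \<and> Y p = Y' p" and "p \<in> U"
    then have "nabla X Y p = nabla X' Y' p"
      by (intro connection_cong[OF conn]) auto
    with eq \<open>p \<in> U\<close> show "(\<lambda>w. nabla X Y p w - g p (X p) (Y p) * T p w) =
        (\<lambda>w. nabla X' Y' p w - g p (X' p) (Y' p) * T p w)" by simp
  next
    fix U X X' Y h k p
    assume *: "U \<subseteq> W" "smooth_vf A U X" "smooth_vf A U X'" "smooth_vf A U Y"
      "smooth_fun A U h" "smooth_fun A U k" "p \<in> U"
    show "(\<lambda>w. nabla (\<lambda>q w. h q * X q w + k q * X' q w) Y p w -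
          g p (\<lambda>w. h p * X p w + k p * X' p w) (Y p) * T p w) =
        (\<lambda>w. h p * (nabla X Y p w - g p (X p) (Y p) * T p w) +
          k p * (nabla X' Y p w - g p (X' p) (Y p) * T p w))"
      unfolding connection_lincomb_left[OF conn *]
        metric_lincomb_left[OF carr[OF *(2,7)] tan[OF *(2,7)] tan[OF *(3,7)] tan[OF *(4,7)]]
      by (simp add: algebra_simps)
  next
    fix U X Y Y' p
    assume *: "U \<subseteq> W" "smooth_vf A U X" "smooth_vf A U Y" "smooth_vf A U Y'" "p \<in> U"
    have "g p (X p) (\<lambda>w. Y p w + Y' p w) = g p (X p) (Y p) + g p (X p) (Y' p)"
      using metric_lincomb_right[OF carr[OF *(2,5)] tan[OF *(3,5)] tan[OF *(4,5)] tan[OF *(2,5)],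
          of 1 1] by simp
    then show "(\<lambda>w. nabla X (\<lambda>q w. Y q w + Y' q w) p w -
          g p (X p) (\<lambda>w. Y p w + Y' p w) * T p w) =
        (\<lambda>w. nabla X Y p w - g p (X p) (Y p) * T p w +
          (nabla X Y' p w - g p (X p) (Y' p) * T p w))"
      unfolding connection_add_right[OF conn *] by (simp add: algebra_simps)
  next
    fix U X Y h p
    assume *: "U \<subseteq> W" "smooth_vf A U X" "smooth_vf A U Y" "smooth_fun A U h" "p \<in> U"
    have "g p (X p) (\<lambda>w. h p * Y p w) = h p * g p (X p) (Y p)"
      using metric_lincomb_right[OF carr[OF *(2,5)] tan[OF *(3,5)] tan[OF *(3,5)] tan[OF *(2,5)],
          of "h p" 0] by simp
    then show "(\<lambda>w. nabla X (\<lambda>q w. h q * Y q w) p w - g p (X p) (\<lambda>w. h p * Y p w) * T p w) =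
        (\<lambda>w. X p h * Y p w + h p * (nabla X Y p w - g p (X p) (Y p) * T p w))"
      unfolding connection_Leibniz[OF conn *] by (simp add: algebra_simps)
  }
qed

text \<open>By symmetry of \<open>g\<close> the subtracted term cancels from the
  antisymmetrization.\<close>

lemma torsion_free_minus_tensor:
  assumes tf: "torsion_free A W nabla" "W' \<subseteq> W"
  shows "torsion_free A W' (\<lambda>X Y p w. nabla X Y p w - g p (X p) (Y p) * T p w)"
  unfolding torsion_free_def
proof (intro allI impI ballI, elim conjE)
  fix U X Y p
  assume *: "U \<subseteq> W'" "smooth_vf A U X" "smooth_vf A U Y" "p \<in> U"
  have "g p (X p) (Y p) = g p (Y p) (X p)"
    using * smooth_vf_carrier[OF *(2)] smooth_vf_tangent[OF *(2)] smooth_vf_tangent[OF *(3)]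
    by (intro metric_sym) auto
  moreover have "(\<lambda>w. nabla X Y p w - nabla Y X p w) = lie_bracket A X Y p"
    using tf(1) * assms(2) unfolding torsion_free_def by blast
  ultimately show "(\<lambda>w. nabla X Y p w - g p (X p) (Y p) * T p w -
      (nabla Y X p w - g p (Y p) (X p) * T p w)) = lie_bracket A X Y p"
    by simp
qed

end

theorem theorem3p1:
  fixes A :: "('m::{t2_space,second_countable_topology}, 'e::euclidean_space) chart set"
    and g :: "'m metric"
    and nabla :: "'m vfield \<Rightarrow> 'm vfield \<Rightarrow> 'm vfield"
    and f lam :: "'m \<Rightarrow> real"
  defines "M0 \<equiv> regular_part A f"
    and "G \<equiv> gradient A g f"
  assumes "smooth_manifold A"
    and "riemannian_metric A g"
    and "levi_civita A g nabla"
    and "smooth_fun A (carrier A) f"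
    and "smooth_fun A M0 lam"
  shows "\<exists>nabla'. affine_connection A M0 nabla' \<and> torsion_free A M0 nabla' \<and>
    (\<forall>U X Y. U \<subseteq> M0 \<and> smooth_vf A U X \<and> smooth_vf A U Y \<longrightarrow>
       (\<forall>p\<in>U. nabla' X Y p =
          (\<lambda>w. nabla X Y p w -
             g p (X p) (Y p) * ((nabla G G p w - lam p * G p w) / (metric_norm g p (G p))\<^sup>2)))) \<and>
    (\<forall>p\<in>M0. nabla' G G p = (\<lambda>w. lam p * G p w)) \<and>
    (\<forall>I \<gamma>. gradient_curve A g f I \<gamma> \<longrightarrow> pregeodesic A M0 nabla' I \<gamma>)"
proof -
  interpret riemannian_manifold A g
    by unfold_locales (rule assms(3), rule assms(4))
  note f = assms(6) and lam = assms(7)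
  have conn: "affine_connection A (carrier A) nabla" and tf: "torsion_free A (carrier A) nabla"
    using assms(5) by (simp_all add: levi_civita_def)
  \<comment> \<open>Openness of the regular part is read off from \<open>lam\<close>, since
    \<open>smooth_fun\<close> includes openness of the domain.\<close>
  have M0: "open M0" "M0 \<subseteq> carrier A"
    using smooth_fun_open[OF lam] smooth_fun_carrier[OF lam] .
  have const: "smooth_fun A M0 (\<lambda>p. r)" for r by (rule smooth_fun_const[OF M0])
  have G: "smooth_vf A M0 G"
    unfolding G_def by (rule smooth_vf_restrict[OF gradient_smooth[OF f] M0])
  have pos: "g p (G p) (G p) > 0" if "p \<in> M0" for p
    using gradient_regular_pos[OF f] that by (simp add: G_def M0_def)
  \<comment> \<open>The norm is kept so that unfolding \<open>T\<close> at the end gives the stated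
    formula literally; \<open>T_eq\<close> gives the form used for smoothness and
    cancellation.\<close>
  define T where "T = (\<lambda>p w. (nabla G G p w - lam p * G p w) / (metric_norm g p (G p))\<^sup>2)"
  have T_eq: "T p w = (nabla G G p w - lam p * G p w) / g p (G p) (G p)" if "p \<in> M0" for p w
    using pos[OF that] by (simp add: T_def metric_norm_def)
  have T: "smooth_vf A M0 T"
  proof -
    have i: "smooth_fun A M0 (\<lambda>p. inverse (g p (G p) (G p)))"
      using pos by (intro smooth_fun_inverse metric_smooth G) (simp add: less_imp_neq[symmetric])
    have "smooth_vf A M0 (\<lambda>p w. inverse (g p (G p) (G p)) * nabla G G p w +
        (- 1 * lam p * inverse (g p (G p) (G p))) * G p w)"
      by (intro smooth_vf_lincomb smooth_fun_mult const lam i G connection_smooth[OF conn M0(2)])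
    then show ?thesis
      by (rule smooth_vf_cong) (simp add: T_eq fun_eq_iff divide_inverse algebra_simps)
  qed
  define nabla' where "nabla' = (\<lambda>X Y p w. nabla X Y p w - g p (X p) (Y p) * T p w)"
  have conn': "affine_connection A M0 nabla'"
    unfolding nabla'_def
    by (rule connection_minus_tensor[OF connection_restrict[OF conn M0] T])
  have GG: "nabla' G G p = (\<lambda>w. lam p * G p w)" if "p \<in> M0" for p
    using pos[OF that] by (simp add: nabla'_def T_eq[OF that])
  have "pregeodesic A M0 nabla' I \<gamma>" if \<gamma>: "gradient_curve A g f I \<gamma>" for I \<gamma>
  proof -
    have "\<gamma> ` I \<subseteq> M0"
      and "integral_curve A G I \<gamma> \<or> integral_curve A (\<lambda>p w. - G p w) I \<gamma>"
      using \<gamma> by (simp_all add: gradient_curve_def G_def M0_def)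
    from this(2) show ?thesis
    proof
      assume "integral_curve A G I \<gamma>"
      from integral_curve_pregeodesic[OF conn' G this \<open>\<gamma> ` I \<subseteq> M0\<close> lam GG]
      show ?thesis .
    next
      assume \<gamma>': "integral_curve A (\<lambda>p w. - G p w) I \<gamma>"
      have "smooth_vf A M0 (\<lambda>p w. - G p w)"
        using smooth_vf_scale[OF const G, of "- 1"] by simp
      moreover have "smooth_fun A M0 (\<lambda>p. - lam p)"
        using smooth_fun_mult[OF const lam, of "- 1"] by simp
      \<comment> \<open>\<open>lam G\<close> is rewritten as a multiple of \<open>- G\<close>, so
        the factor for descending curves is \<open>- lam\<close>.\<close>
      moreover have "nabla' (\<lambda>p w. - G p w) (\<lambda>p w. - G p w) p = (\<lambda>w. - lam p * - G p w)"
        if "p \<in> M0" for p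
        using connection_negate[OF conn' order.refl G G that] GG[OF that] by simp
      ultimately show ?thesis
        using integral_curve_pregeodesic[OF conn' _ \<gamma>' \<open>\<gamma> ` I \<subseteq> M0\<close>, of "\<lambda>p. - lam p"] by blast
    qed
  qed
  then have result: "affine_connection A M0 nabla' \<and> torsion_free A M0 nabla' \<and>
    (\<forall>U X Y. U \<subseteq> M0 \<and> smooth_vf A U X \<and> smooth_vf A U Y \<longrightarrow>
       (\<forall>p\<in>U. nabla' X Y p = (\<lambda>w. nabla X Y p w - g p (X p) (Y p) * T p w))) \<and>
    (\<forall>p\<in>M0. nabla' G G p = (\<lambda>w. lam p * G p w)) \<and>
    (\<forall>I \<gamma>. gradient_curve A g f I \<gamma> \<longrightarrow> pregeodesic A M0 nabla' I \<gamma>)"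
    using conn' torsion_free_minus_tensor[OF tf M0(2)] GG unfolding nabla'_def by simp
  show ?thesis
    by (rule exI[of _ nabla']) (rule result[unfolded T_def])
qed

end
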